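(* For every integer $n>1$, $f(n)<n$.
   Context: For an integer $n>1$, consider the equation $$n=\left(X+\frac1x\right)\left(Y+\frac1y\right)$$ in positive integers $X,x,Y,y$ with $x>1$ and $y>1$. Two solutions obtained from each other by transposing the pairs $(X,x)$ and $(Y,y)$ are identified, and $f(n)$ denotes the number of solutions up to this identification. Since $x\neq y$ in every solution, $f(n)$ is equivalently the number of quadruples $(X,x,Y,y)$ of positive integers satisfying the equation with $1<x<y$. *)

theory Defs
  imports Complex_Main
begin

text \<open>A solution is stored as \<open>((X, x), (Y, y))\<close>, so that transposing the two pairs is
  \<^const>\<open>prod.swap\<close>.\<close>

definition solutions :: "nat \<Rightarrow> ((nat \<times> nat) \<times> (nat \<times> nat)) set" where
  "solutions n = {((X, x), (Y, y)) | X x Y y.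
     X > 0 \<and> Y > 0 \<and> x > 1 \<and> y > 1 \<and>
     real n = (real X + 1 / real x) * (real Y + 1 / real y)}"

definition transposed ::
  "nat \<Rightarrow> (((nat \<times> nat) \<times> (nat \<times> nat)) \<times> ((nat \<times> nat) \<times> (nat \<times> nat))) set" where
  "transposed n = {(s, t). s \<in> solutions n \<and> t \<in> solutions n \<and> (t = s \<or> t = prod.swap s)}"

lemma equiv_transposed: "equiv (solutions n) (transposed n)"
  by (rule equivI) (auto simp: transposed_def refl_on_def sym_def trans_def)

definition solution_classes :: "nat \<Rightarrow> ((nat \<times> nat) \<times> (nat \<times> nat)) set set" where
  "solution_classes n = solutions n // transposed n"

definition f :: "nat \<Rightarrow> nat" where
  "f n = card (solution_classes n)"

end

theory Submission
  imports Defs "HOL-Computational_Algebra.Primes" "HOL-Library.Code_Binary_Nat"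
begin

text \<open>
  Since \<open>x\<close> is coprime to \<open>X x + 1\<close> and \<open>y\<close> to \<open>Y y + 1\<close>, a solution can be written with
  \<open>Y y + 1 = a x\<close>, \<open>X x + 1 = b y\<close>, \<open>a b = n\<close>, and then \<open>k = n - X Y\<close> is positive and satisfies
  \<open>k x = b + Y\<close>, \<open>k y = a + X\<close>. Normalise by \<open>X \<le> Y\<close>, so that \<open>X\<^sup>2 < n\<close>. Given \<open>(a, b)\<close>,

  \<^item> if \<open>k \<le> X\<close>, then \<open>k\<close> is determined by \<open>k \<equiv> n (mod X)\<close>;
  \<^item> if \<open>y \<le> X\<close>, then \<open>y\<close> is determined by \<open>b y \<equiv> 1 (mod X)\<close>;
  \<^item> otherwise \<open>0 < X = k y - a < min k y\<close>, so \<open>k\<close> and \<open>y\<close> determine each other and the smaller one is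
    at most about \<open>sqrt a\<close>.

  As \<open>X\<close> and \<open>b\<close> are not both even, this gives \<open>f n < n\<close> whenever
  \<open>4 d(n) + 3 d\<^sub>o(n) + 30 \<le> 3 sqrt n\<close>, where \<open>d\<close> and \<open>d\<^sub>o\<close> count the divisors and the odd divisors.
  Writing \<open>n = 2\<^sup>e 3\<^sup>i 5\<^sup>j 7\<^sup>k m\<close> with \<open>m\<close> free of primes below 11 leaves about a thousand exceptional \<open>n\<close>
  (the largest is 16380). For those the same injections are counted by evaluation, testing
  \<open>k dvd a + X\<close> in the first case; for some \<open>n \<le> 630\<close> even this is too weak and all solutions are enumerated.
\<close>

section \<open>Parametrisation of the solutions\<close>

text \<open>Swapping the two pairs of a solution swaps \<open>a\<close> and \<open>b\<close>; the last condition picks one of the two.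
  The remaining possibility \<open>X = Y\<close>, \<open>a = b\<close> would force \<open>x = y\<close>, contradicting coprimality.\<close>

definition params :: "nat \<Rightarrow> (nat \<times> nat \<times> nat \<times> nat \<times> nat \<times> nat \<times> nat) set" where
  "params n = {(X, x, Y, y, a, b, k). 0 < X \<and> 0 < Y \<and> 1 < x \<and> 1 < y \<and> 0 < k \<and>
     a * b = n \<and> X * Y + k = n \<and> k * x = b + Y \<and> k * y = a + X \<and>
     X * x + 1 = b * y \<and> Y * y + 1 = a * x \<and> (X < Y \<or> X = Y \<and> b < a)}"

lemma paramsD:
  assumes "(X, x, Y, y, a, b, k) \<in> params n"
  shows "0 < X" "0 < Y" "1 < x" "1 < y" "0 < k" "a * b = n" "X * Y + k = n" "k * x = b + Y"
    "k * y = a + X" "X * x + 1 = b * y" "Y * y + 1 = a * x" "X \<le> Y" "X < Y \<or> X = Y \<and> b < a"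
proof -
  have *: "0 < X \<and> 0 < Y \<and> 1 < x \<and> 1 < y \<and> 0 < k \<and>
     a * b = n \<and> X * Y + k = n \<and> k * x = b + Y \<and> k * y = a + X \<and>
     X * x + 1 = b * y \<and> Y * y + 1 = a * x \<and> (X < Y \<or> X = Y \<and> b < a)"
    using assms by (simp only: params_def mem_Collect_eq prod.case)
  then show "0 < X" "0 < Y" "1 < x" "1 < y" "0 < k" "a * b = n" "X * Y + k = n" "k * x = b + Y"
    "k * y = a + X" "X * x + 1 = b * y" "Y * y + 1 = a * x" "X < Y \<or> X = Y \<and> b < a"
    by - (elim conjE; assumption)+
  then show "X \<le> Y" by linarith
qed

lemma solutions_iff:
  "((X, x), (Y, y)) \<in> solutions n \<longleftrightarrow>
     0 < X \<and> 0 < Y \<and> 1 < x \<and> 1 < y \<and> n * x * y = (X * x + 1) * (Y * y + 1)"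
proof -
  have "real n = (real X + 1 / real x) * (real Y + 1 / real y) \<longleftrightarrow>
      n * x * y = (X * x + 1) * (Y * y + 1)" if "1 < x" "1 < y"
  proof -
    have "real n = (real X + 1 / real x) * (real Y + 1 / real y) \<longleftrightarrow>
        real n * real x * real y = (real X * real x + 1) * (real Y * real y + 1)"
      using that by (simp add: field_simps)
    also have "\<dots> \<longleftrightarrow> real (n * x * y) = real ((X * x + 1) * (Y * y + 1))"
      by (simp only: of_nat_mult of_nat_add of_nat_1)
    finally show ?thesis
      by (simp only: of_nat_eq_iff)
  qed
  then show ?thesis
    by (auto simp: solutions_def)
qed

lemma solution_parameters:
  fixes X x Y y n :: nat
  assumes pos: "0 < X" "0 < Y" "1 < x" "1 < y"
    and eq: "n * x * y = (X * x + 1) * (Y * y + 1)"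
  obtains a b k where "0 < k" "a * b = n" "X * Y + k = n" "k * x = b + Y" "k * y = a + X"
    "X * x + 1 = b * y" "Y * y + 1 = a * x"
proof -
  have cop: "coprime z (Z * z + 1)" for z Z :: nat
    by (rule coprimeI) (use dvd_add_right_iff dvd_mult in blast)
  have "x dvd Y * y + 1"
    using cop[of x X] eq coprime_dvd_mult_right_iff[of x "X * x + 1" "Y * y + 1"]
    by (metis dvd_triv_left mult.assoc mult.commute)
  then obtain a where a: "Y * y + 1 = a * x"
    by (metis dvd_def mult.commute)
  have "y dvd X * x + 1"
    using cop[of y Y] eq coprime_dvd_mult_left_iff[of y "Y * y + 1" "X * x + 1"]
    by (metis dvd_triv_right)
  then obtain b where b: "X * x + 1 = b * y"
    by (metis dvd_def mult.commute)
  have "n * (x * y) = (a * b) * (x * y)"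
    using eq unfolding a b by (simp add: ac_simps)
  then have n: "a * b = n"
    using pos by simp
  \<comment> \<open>Subtracting \<open>X * Y * x * y\<close> from the expanded equation leaves
    \<open>k * x * y = X * x + Y * y + 1\<close>. Substituting \<open>b * y\<close> for
    \<open>X * x + 1\<close>, or \<open>a * x\<close> for \<open>Y * y + 1\<close>, makes one factor
    cancel.\<close>
  have nxy: "n * (x * y) = (X * Y) * (x * y) + (X * x + Y * y + 1)"
    using eq by (simp add: algebra_simps)
  then have "(X * Y) * (x * y) < n * (x * y)"
    by simp
  then have lt: "X * Y < n"
    using mult_less_cancel2 by blast
  define k where "k = n - X * Y"
  have k: "X * Y + k = n" "0 < k"
    using lt by (auto simp: k_def)
  have kxy: "k * (x * y) = X * x + Y * y + 1"
    using nxy unfolding k(1)[symmetric] by (simp add: algebra_simps)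
  have "(k * x) * y = (b + Y) * y"
    using kxy b by (simp add: algebra_simps)
  then have kx: "k * x = b + Y"
    using pos by simp
  have "(k * y) * x = (a + X) * x"
    using kxy a by (simp add: algebra_simps)
  then have ky: "k * y = a + X"
    using pos by simp
  show thesis
    using that k n kx ky a b by blast
qed

text \<open>Crude bounds that serve only to show that \<open>params n\<close> is finite.\<close>

lemma params_bounds:
  assumes "(X, x, Y, y, a, b, k) \<in> params n"
  shows "X \<le> n" "x \<le> 2 * n" "Y \<le> n" "y \<le> 2 * n" "a \<le> n" "b \<le> n" "k \<le> n"
proof -
  note p = paramsD[OF assms]
  have "X * 1 \<le> X * Y" "1 * Y \<le> X * Y" using p by (intro mult_le_mono; simp)+
  then show XY: "X \<le> n" "Y \<le> n" using p(7) by linarith+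
  have "0 < a" "0 < b" using p(10,11) by (auto intro: Nat.gr0I)
  then have "a * 1 \<le> a * b" "1 * b \<le> a * b" by (intro mult_le_mono; simp)+
  then show ab: "a \<le> n" "b \<le> n" using p(6) by linarith+
  show "k \<le> n" using p(7) by linarith
  have "1 * x \<le> k * x" "1 * y \<le> k * y" using p by (intro mult_le_mono; simp)+
  then show "x \<le> 2 * n" "y \<le> 2 * n" using p(8,9) XY ab by linarith+
qed

lemma finite_params: "finite (params n)"
proof (rule finite_subset)
  show "params n \<subseteq> {..n} \<times> {..2*n} \<times> {..n} \<times> {..2*n} \<times> {..n} \<times> {..n} \<times> {..n}"
  proof
    fix t assume t: "t \<in> params n"
    obtain X x Y y a b k where [simp]: "t = (X, x, Y, y, a, b, k)" by (metis prod.exhaust)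
    show "t \<in> {..n} \<times> {..2*n} \<times> {..n} \<times> {..2*n} \<times> {..n} \<times> {..n} \<times> {..n}"
      using params_bounds[of X x Y y a b k n] t by auto
  qed
qed auto

lemma solution_classes_subset:
  "solution_classes n \<subseteq> (\<lambda>(X, x, Y, y, a, b, k). transposed n `` {((X, x), (Y, y))}) ` params n"
proof
  fix C assume "C \<in> solution_classes n"
  then obtain s where s: "s \<in> solutions n" "C = transposed n `` {s}"
    by (auto simp: solution_classes_def quotient_def)
  obtain X x Y y where s_eq: "s = ((X, x), (Y, y))" by (metis prod.exhaust)
  have sol: "0 < X" "0 < Y" "1 < x" "1 < y" "n * x * y = (X * x + 1) * (Y * y + 1)"
    using s(1) unfolding s_eq solutions_iff by auto
  obtain a b k where abk: "0 < k" "a * b = n" "X * Y + k = n" "k * x = b + Y" "k * y = a + X"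
    "X * x + 1 = b * y" "Y * y + 1 = a * x"
    using solution_parameters[OF sol] .
  have swapped: "((Y, y), (X, x)) \<in> solutions n"
    using sol unfolding solutions_iff by (simp add: ac_simps)
  have C: "C = transposed n `` {((Y, y), (X, x))}"
    using equiv_class_eq[OF equiv_transposed, of s "((Y, y), (X, x))" n] s swapped
    by (auto simp: transposed_def s_eq)
  consider "X < Y \<or> X = Y \<and> b < a" | "Y < X \<or> Y = X \<and> a < b" | "X = Y" "a = b"
    by linarith
  then show "C \<in> (\<lambda>(X, x, Y, y, a, b, k). transposed n `` {((X, x), (Y, y))}) ` params n"
  proof cases
    case 1
    then have "(X, x, Y, y, a, b, k) \<in> params n"
      using sol abk by (auto simp: params_def)
    then show ?thesis
      using s s_eq by (auto intro!: image_eqI)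
  next
    case 2
    then have "(Y, y, X, x, b, a, k) \<in> params n"
      using sol abk by (auto simp: params_def ac_simps)
    then show ?thesis
      using C by (auto intro!: image_eqI)
  next
    case 3
    then have "k * x = k * y" using abk(4,5) by linarith
    then have "x = y" using abk(1) by simp
    then have "x dvd X * x + 1" using abk(6) by simp
    then have "x dvd 1" by (metis dvd_add_right_iff dvd_triv_right)
    then show ?thesis
      using sol by simp
  qed
qed

lemma solution_classes_bound: "finite (solution_classes n)" "f n \<le> card (params n)"
proof -
  show "finite (solution_classes n)"
    by (rule finite_subset[OF solution_classes_subset finite_imageI[OF finite_params]])
  show "f n \<le> card (params n)"
    unfolding f_def by (rule surj_card_le[OF finite_params solution_classes_subset])
qed

section \<open>Four regions of parameters and their injections into sets of triples\<close>

definition region_A :: "nat \<Rightarrow> (nat \<times> nat \<times> nat \<times> nat \<times> nat \<times> nat \<times> nat) set" where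
  "region_A n = {(X, x, Y, y, a, b, k) \<in> params n. k \<le> X}"

definition region_B :: "nat \<Rightarrow> (nat \<times> nat \<times> nat \<times> nat \<times> nat \<times> nat \<times> nat) set" where
  "region_B n = {(X, x, Y, y, a, b, k) \<in> params n. y \<le> X \<and> X < k}"

text \<open>This region and the next are the third case of the introduction, split according to
  which of \<open>k\<close> and \<open>y\<close> is smaller.\<close>

definition region_C :: "nat \<Rightarrow> (nat \<times> nat \<times> nat \<times> nat \<times> nat \<times> nat \<times> nat) set" where
  "region_C n = {(X, x, Y, y, a, b, k) \<in> params n. X < k \<and> k \<le> y}"

definition region_D :: "nat \<Rightarrow> (nat \<times> nat \<times> nat \<times> nat \<times> nat \<times> nat \<times> nat) set" where
  "region_D n = {(X, x, Y, y, a, b, k) \<in> params n. X < y \<and> y < k}"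

lemma card_params_le:
  "card (params n) \<le> card (region_A n) + card (region_B n) + card (region_C n) + card (region_D n)"
proof -
  have "params n = (region_A n \<union> region_B n) \<union> (region_C n \<union> region_D n)"
    by (auto simp: region_A_def region_B_def region_C_def region_D_def)
  then have "card (params n) \<le> card (region_A n \<union> region_B n) + card (region_C n \<union> region_D n)"
    by (metis card_Un_le)
  also have "\<dots> \<le> (card (region_A n) + card (region_B n)) + (card (region_C n) + card (region_D n))"
    by (intro add_mono card_Un_le)
  finally show ?thesis by simp
qed

text \<open>If \<open>X\<close> and \<open>b\<close> were both even,
  \<open>X * x + 1 = b * y\<close> would equate an odd and an even number; likewise for
  \<open>Y * y + 1 = a * x\<close>.\<close>

lemma params_parity:
  assumes "(X, x, Y, y, a, b, k) \<in> params n"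
  shows "odd X \<or> odd b" "odd a \<or> odd y"
proof -
  have "X * x + 1 = b * y" "Y * y + 1 = a * x" by (rule paramsD[OF assms])+
  then show "odd X \<or> odd b" "odd a \<or> odd y"
    by (metis even_mult_iff even_plus_one_iff)+
qed

lemma params_square:
  assumes "(X, x, Y, y, a, b, k) \<in> params n"
  shows "X * X < n"
proof -
  have "X \<le> Y" "X * Y + k = n" "0 < k" by (rule paramsD[OF assms])+
  then show ?thesis using mult_le_mono2[of X Y X] by linarith
qed

text \<open>Uniqueness of quotient and remainder, with remainders in \<open>{1..m}\<close> instead
  of \<open>{0..<m}\<close>; hence the shift by one.\<close>

lemma eq_if_close:
  fixes q r q' r' m :: nat
  assumes "m * q + r = m * q' + r'" "0 < r" "r \<le> m" "0 < r'" "r' \<le> m"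
  shows "q = q'" "r = r'"
proof -
  define t t' where "t = r - 1" and "t' = r' - 1"
  have t: "r = t + 1" "r' = t' + 1" "t < m" "t' < m" using assms by (auto simp: t_def t'_def)
  then have e: "m * q + t = m * q' + t'" using assms(1) by simp
  have "(m * q + t) div m = q" "(m * q' + t') div m = q'" using t by simp_all
  then show "q = q'" using e by simp
  then show "r = r'" using assms(1) by simp
qed

text \<open>The residue of \<open>n\<close> modulo \<open>X\<close> that lies in \<open>{1..X}\<close> rather than in \<open>{0..<X}\<close>.\<close>

definition least_residue :: "nat \<Rightarrow> nat \<Rightarrow> nat" where
  "least_residue n X = (n - 1) mod X + 1"

definition A_pairs :: "nat \<Rightarrow> (nat \<times> nat \<times> nat) set" where
  "A_pairs n = {(X, a, b). 0 < X \<and> X * X < n \<and> a * b = n \<and> (odd X \<or> odd b) \<and>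
     least_residue n X dvd a + X}"

text \<open>The last inequality comes from \<open>k * (b * y) = b * (a + X) = n + b * X\<close> and
  the lower bounds \<open>X + 1\<close> for \<open>k\<close> and \<open>2 * X + 1\<close> for
  \<open>b * y\<close>, the latter because \<open>x\<close> is at least 2.\<close>

definition B_pairs :: "nat \<Rightarrow> (nat \<times> nat \<times> nat) set" where
  "B_pairs n = {(X, a, b). 0 < X \<and> X * X < n \<and> a * b = n \<and> (odd X \<or> odd b) \<and>
     2 < b \<and> b * X < n \<and> (X + 1) * (2 * X + 1) \<le> n + b * X}"

text \<open>Since \<open>k \<le> y\<close> and \<open>X < k\<close>, the number
  \<open>a = k * y - X\<close> exceeds \<open>k * k - k\<close>. In \<open>D_pairs\<close>,
  \<open>y < k\<close> and \<open>X < y\<close> give \<open>a > (y + 1) * y - y\<close> in the same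
  way.\<close>

definition C_pairs :: "nat \<Rightarrow> (nat \<times> nat \<times> nat) set" where
  "C_pairs n = {(k, a, b). 2 \<le> k \<and> k * (k - 1) < a \<and> a * b = n}"

definition D_pairs :: "nat \<Rightarrow> (nat \<times> nat \<times> nat) set" where
  "D_pairs n = {(y, a, b). 2 \<le> y \<and> y * y < a \<and> a * b = n \<and> (odd a \<or> odd y)}"

lemma finite_divisor_pairs: "0 < n \<Longrightarrow> finite {(a, b). a * b = (n::nat)}"
  by (rule finite_subset[of _ "{..n} \<times> {..n}"]) auto

lemma pairs_bounds:
  assumes "a * b = (n::nat)" "0 < n" shows "a \<le> n" "b \<le> n"
  using assms by auto

lemma finite_region_pairs:
  assumes "0 < n"
  shows "finite (A_pairs n)" "finite (B_pairs n)" "finite (C_pairs n)" "finite (D_pairs n)"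
proof -
  have sq: "X \<le> m" if "X * X < m" for X m :: nat
    using that by (metis le_square le_trans less_imp_le)
  have sq': "X \<le> m" if "X * (X - 1) < m" "2 \<le> X" for X m :: nat
    using that mult_le_mono2[of 1 "X - 1" X] by linarith
  have "A_pairs n \<subseteq> {..n} \<times> {..n} \<times> {..n}" "B_pairs n \<subseteq> {..n} \<times> {..n} \<times> {..n}"
    "C_pairs n \<subseteq> {..n} \<times> {..n} \<times> {..n}" "D_pairs n \<subseteq> {..n} \<times> {..n} \<times> {..n}"
    using assms
    by (auto simp: A_pairs_def B_pairs_def C_pairs_def D_pairs_def
        dest: sq sq' intro: pairs_bounds order_trans[OF sq] order_trans[OF sq'])
  then show "finite (A_pairs n)" "finite (B_pairs n)" "finite (C_pairs n)" "finite (D_pairs n)"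
    by (meson finite_SigmaI finite_atMost finite_subset)+
qed

text \<open>Writing \<open>n = X * Y + k\<close> with \<open>k\<close> in \<open>{1..X}\<close>
  fixes \<open>Y\<close> and \<open>k\<close>; then \<open>k * x = b + Y\<close> and
  \<open>k * y = a + X\<close> fix \<open>x\<close> and \<open>y\<close>.\<close>

lemma card_region_A_le:
  assumes "0 < n"
  shows "card (region_A n) \<le> card (A_pairs n)"
proof (rule card_inj_on_le)
  let ?g = "\<lambda>(X, x, Y, y, a, b, k). (X, a, b) :: nat \<times> nat \<times> nat"
  show "finite (A_pairs n)" using finite_region_pairs[OF assms] by blast
  show "inj_on ?g (region_A n)"
  proof (rule inj_onI, clarsimp simp: region_A_def)
    fix X x Y y a b k x' Y' y' k'
    assume p: "(X, x, Y, y, a, b, k) \<in> params n" "(X, x', Y', y', a, b, k') \<in> params n"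
      and k: "k \<le> X" "k' \<le> X"
    note q = paramsD[OF p(1)] and q' = paramsD[OF p(2)]
    have "X * Y + k = X * Y' + k'" using q(7) q'(7) by simp
    then have "Y = Y'" "k = k'" using eq_if_close k q(5) q'(5) by blast+
    then have "k * x = k * x'" "k * y = k * y'" using q(8,9) q'(8,9) by simp_all
    then show "x = x' \<and> Y = Y' \<and> y = y' \<and> k = k'"
      using q(5) \<open>Y = Y'\<close> \<open>k = k'\<close> by simp
  qed
  show "?g ` region_A n \<subseteq> A_pairs n"
  proof (clarsimp simp: region_A_def)
    fix X x Y y a b k
    assume p: "(X, x, Y, y, a, b, k) \<in> params n" and k: "k \<le> X"
    obtain c where c: "k = Suc c" using paramsD(5)[OF p] by (cases k) auto
    then have "n - 1 = c + X * Y" "c < X" using paramsD(7)[OF p] k by linarith+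
    then have "least_residue n X = k" by (simp add: least_residue_def c)
    moreover have "k dvd a + X" unfolding paramsD(9)[OF p, symmetric] by simp
    ultimately show "(X, a, b) \<in> A_pairs n"
      using paramsD(1,6)[OF p] params_square[OF p] params_parity(1)[OF p]
      by (simp add: A_pairs_def)
  qed
qed

text \<open>As \<open>b\<close> is invertible modulo \<open>X\<close>, the residue of
  \<open>y\<close> is fixed, and \<open>y\<close> lies in \<open>{1..X}\<close>. From
  \<open>y\<close> one recovers \<open>x\<close>, then \<open>k\<close>, then
  \<open>Y\<close>.\<close>

lemma card_region_B_le:
  assumes "0 < n"
  shows "card (region_B n) \<le> card (B_pairs n)"
proof (rule card_inj_on_le)
  let ?g = "\<lambda>(X, x, Y, y, a, b, k). (X, a, b) :: nat \<times> nat \<times> nat"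
  show "finite (B_pairs n)" using finite_region_pairs[OF assms] by blast
  show "inj_on ?g (region_B n)"
  proof (rule inj_onI, clarsimp simp: region_B_def)
    fix X x Y y a b k x' Y' y' k'
    assume p: "(X, x, Y, y, a, b, k) \<in> params n" "(X, x', Y', y', a, b, k') \<in> params n"
      and y: "y \<le> X" "y' \<le> X" "X < k" "X < k'"
    note q = paramsD[OF p(1)] and q' = paramsD[OF p(2)]
    note e = q(10) q'(10)
    have "coprime X b"
    proof (rule coprimeI)
      fix c assume "c dvd X" "c dvd b"
      then have "c dvd X * x" "c dvd X * x + 1" using e by auto
      then show "is_unit c" by (metis dvd_add_right_iff)
    qed
    have "int X dvd int b * (int y - int y')"
    proof -
      have "int X * int x + 1 = int b * int y" "int X * int x' + 1 = int b * int y'"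
        using e by (metis of_nat_mult of_nat_add of_nat_1)+
      then have "int b * (int y - int y') = int X * (int x - int x')"
        by (simp add: algebra_simps)
      then show ?thesis by simp
    qed
    then have "int X dvd int y - int y'"
      using \<open>coprime X b\<close> by (metis coprime_dvd_mult_right_iff coprime_int_iff)
    moreover have "\<bar>int y - int y'\<bar> < int X" using q(4) q'(4) y by linarith
    ultimately have "y = y'" using zdvd_imp_le[of "int X" "\<bar>int y - int y'\<bar>"] by fastforce
    then have "X * x = X * x'" using e by (metis add_right_imp_eq)
    then have "x = x'" using q(1) by simp
    have "k * y = k' * y" using q(9) q'(9) \<open>y = y'\<close> by simp
    then have "k = k'" using q(4) by simp
    then have "X * Y = X * Y'" using q(7) q'(7) unfolding \<open>k = k'\<close> by linarith
    then have "Y = Y'" using q(1) by simp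
    show "x = x' \<and> Y = Y' \<and> y = y' \<and> k = k'"
      using \<open>x = x'\<close> \<open>y = y'\<close> \<open>k = k'\<close> \<open>Y = Y'\<close> by simp
  qed
  show "?g ` region_B n \<subseteq> B_pairs n"
  proof (clarsimp simp: region_B_def)
    fix X x Y y a b k
    assume p: "(X, x, Y, y, a, b, k) \<in> params n" and y: "y \<le> X" "X < k"
    have q: "1 < x" "1 < y" "0 < X" "a * b = n" "k * y = a + X" "X * x + 1 = b * y"
      by (rule paramsD[OF p])+
    have "X * 2 \<le> X * x" using q by simp
    then have by1: "2 * X + 1 \<le> b * y" using q by linarith
    have "(X + 1) * y \<le> a + X" using mult_le_mono1[of "X + 1" k y] y q by simp
    have "(X + 1) * (2 * X + 1) \<le> (X + 1) * (b * y)" using by1 by (rule mult_le_mono2)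
    also have "\<dots> = b * ((X + 1) * y)" by (simp only: mult_ac)
    also have "\<dots> \<le> b * (a + X)" using \<open>(X + 1) * y \<le> a + X\<close> by (rule mult_le_mono2)
    also have "\<dots> = n + b * X" using q by (simp add: algebra_simps)
    finally have 1: "(X + 1) * (2 * X + 1) \<le> n + b * X" .
    have "(X + 1) * 2 \<le> (X + 1) * y" using q by (intro mult_le_mono2) simp
    then have "(X + 1) * 2 \<le> a + X" using \<open>(X + 1) * y \<le> a + X\<close> by (rule le_trans)
    then have "X < a" by simp
    have "2 * y < b * y" using by1 y by linarith
    then have "2 < b" by simp
    then have "b * X < n" using \<open>X < a\<close> q mult_less_mono2[of X a b] by (simp add: mult.commute)
    then show "(X, a, b) \<in> B_pairs n"
      using 1 \<open>2 < b\<close> q params_square[OF p] params_parity(1)[OF p]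
      by (auto simp: B_pairs_def)
  qed
qed

lemma card_region_C_le:
  assumes "0 < n"
  shows "card (region_C n) \<le> card (C_pairs n)"
proof (rule card_inj_on_le)
  let ?g = "\<lambda>(X, x, Y, y, a, b, k). (k, a, b) :: nat \<times> nat \<times> nat"
  show "finite (C_pairs n)" using finite_region_pairs[OF assms] by blast
  show "inj_on ?g (region_C n)"
  proof (rule inj_onI, clarsimp simp: region_C_def)
    fix X x Y y a b k X' x' Y' y'
    assume p: "(X, x, Y, y, a, b, k) \<in> params n" "(X', x', Y', y', a, b, k) \<in> params n"
      and X: "X < k" "X' < k"
    note q = paramsD[OF p(1)] and q' = paramsD[OF p(2)]
    \<comment> \<open>Both \<open>k * y - X\<close> and \<open>k * y' - X'\<close> equal
      \<open>a\<close>. Adding crosswise turns \<open>X'\<close> and \<open>X\<close> into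
      remainders modulo \<open>k\<close>.\<close>
    have "k * y + X' = k * y' + X" using q(9) q'(9) by simp
    then have "y = y'" "X' = X" using eq_if_close[of k y X' y' X] X q(1) q'(1) by simp_all
    then have "X * Y = X * Y'" using q(7) q'(7) unfolding \<open>X' = X\<close> by linarith
    then have "Y = Y'" using q(1) by simp
    then have "k * x = k * x'" using q(8) q'(8) by simp
    then show "X = X' \<and> x = x' \<and> Y = Y' \<and> y = y'"
      using q(5) \<open>y = y'\<close> \<open>X' = X\<close> \<open>Y = Y'\<close> by simp
  qed
  show "?g ` region_C n \<subseteq> C_pairs n"
  proof (clarsimp simp: region_C_def)
    fix X x Y y a b k
    assume p: "(X, x, Y, y, a, b, k) \<in> params n" and k: "X < k" "k \<le> y"
    have q: "0 < X" "a * b = n" "k * y = a + X" by (rule paramsD[OF p])+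
    have "k * (k - 1) + k = k * k" using k by (cases k) auto
    moreover have "k * k \<le> k * y" using k by simp
    ultimately have "k * (k - 1) < a" using q k by linarith
    then show "(k, a, b) \<in> C_pairs n" using q k by (simp add: C_pairs_def)
  qed
qed

text \<open>The argument for \<open>region_C\<close> with \<open>k\<close> and \<open>y\<close>
  exchanged.\<close>

lemma card_region_D_le:
  assumes "0 < n"
  shows "card (region_D n) \<le> card (D_pairs n)"
proof (rule card_inj_on_le)
  let ?g = "\<lambda>(X, x, Y, y, a, b, k). (y, a, b) :: nat \<times> nat \<times> nat"
  show "finite (D_pairs n)" using finite_region_pairs[OF assms] by blast
  show "inj_on ?g (region_D n)"
  proof (rule inj_onI, clarsimp simp: region_D_def)
    fix X x Y y a b k X' x' Y' k'
    assume p: "(X, x, Y, y, a, b, k) \<in> params n" "(X', x', Y', y, a, b, k') \<in> params n"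
      and X: "X < y" "X' < y"
    note q = paramsD[OF p(1)] and q' = paramsD[OF p(2)]
    have "y * k + X' = y * k' + X" using q(9) q'(9) by (simp add: mult.commute)
    then have "k = k'" "X' = X" using eq_if_close[of y k X' k' X] X q(1) q'(1) by simp_all
    then have "X * Y = X * Y'" using q(7) q'(7) unfolding \<open>X' = X\<close> \<open>k = k'\<close> by linarith
    then have "Y = Y'" using q(1) by simp
    then have "k * x = k * x'" using q(8) q'(8) \<open>k = k'\<close> by simp
    then show "X = X' \<and> x = x' \<and> Y = Y' \<and> k = k'"
      using q(5) \<open>k = k'\<close> \<open>X' = X\<close> \<open>Y = Y'\<close> by simp
  qed
  show "?g ` region_D n \<subseteq> D_pairs n"
  proof (clarsimp simp: region_D_def)
    fix X x Y y a b k
    assume p: "(X, x, Y, y, a, b, k) \<in> params n" and k: "X < y" "y < k"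
    have q: "1 < y" "a * b = n" "k * y = a + X" by (rule paramsD[OF p])+
    have "(y + 1) * y \<le> k * y" using k by (intro mult_le_mono1) simp
    then have "y * y < a" using q k by simp
    then show "(y, a, b) \<in> D_pairs n"
      using q k params_parity(2)[OF p] by (simp add: D_pairs_def)
  qed
qed

lemma f_le_pairs:
  assumes "0 < n"
  shows "f n \<le> card (A_pairs n) + card (B_pairs n) + card (C_pairs n) + card (D_pairs n)"
  using solution_classes_bound(2)[of n] card_params_le[of n] card_region_A_le[OF assms]
    card_region_B_le[OF assms] card_region_C_le[OF assms] card_region_D_le[OF assms]
  by linarith

section \<open>Few divisors\<close>

lemma finite_squares_below: "finite {X::nat. 0 < X \<and> X * X < n}"
proof (rule finite_subset)
  show "{X::nat. 0 < X \<and> X * X < n} \<subseteq> {..n}"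
  proof
    fix X assume "X \<in> {X::nat. 0 < X \<and> X * X < n}"
    then have "X * X < n" by simp
    then show "X \<in> {..n}" using le_square[of X] unfolding atMost_iff by linarith
  qed
qed simp

text \<open>The set lies in \<open>{1..M}\<close> for its maximum \<open>M\<close>, which is below
  \<open>sqrt n\<close>. The strictness here is what later makes \<open>f n < n\<close>
  strict.\<close>

lemma card_squares_below:
  assumes "0 < n"
  shows "real (card {X. 0 < X \<and> X * X < n}) < sqrt (real n)"
proof (cases "{X::nat. 0 < X \<and> X * X < n} = {}")
  case True
  then show ?thesis using assms by (simp only: card.empty) simp
next
  case False
  let ?S = "{X::nat. 0 < X \<and> X * X < n}"
  have fin: "finite ?S" by (rule finite_squares_below)
  have "Max ?S \<in> ?S" using Max_in[OF fin False] .
  then have "Max ?S * Max ?S < n" by blast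
  then have "real (Max ?S * Max ?S) < real n" by (simp only: of_nat_less_iff)
  then have "real (Max ?S) < sqrt (real n)" by (intro real_less_rsqrt) (simp add: power2_eq_square)
  moreover have "card ?S \<le> Max ?S"
  proof -
    have "?S \<subseteq> {1..Max ?S}"
    proof
      fix X assume X: "X \<in> ?S"
      then have "X \<le> Max ?S" by (rule Max_ge[OF fin])
      then show "X \<in> {1..Max ?S}" using X by simp
    qed
    then have "card ?S \<le> card {1..Max ?S}" by (intro card_mono) simp_all
    then show ?thesis by simp
  qed
  ultimately show ?thesis by linarith
qed

lemma divisor_pairs_image:
  assumes "0 < n"
  shows "{(a, b). a * b = (n::nat)} = (\<lambda>b. (n div b, b)) ` {b. b dvd n}"
proof (intro set_eqI iffI)
  fix p assume "p \<in> {(a, b). a * b = n}"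
  then obtain a b where p: "p = (a, b)" "a * b = n" by blast
  then have "0 < b" using assms by (auto intro: Nat.gr0I)
  then have "n div b = a" unfolding p(2)[symmetric] by simp
  moreover have "b dvd n" using p(2) by (metis dvd_triv_right)
  ultimately show "p \<in> (\<lambda>b. (n div b, b)) ` {b. b dvd n}" using p(1) by blast
qed auto

lemma sum_divisor_pairs:
  assumes "0 < n"
  shows "(\<Sum>p\<in>{(a, b). a * b = (n::nat)}. g p) = (\<Sum>b | b dvd n. g (n div b, b))"
  unfolding divisor_pairs_image[OF assms] by (subst sum.reindex) (auto simp: inj_on_def)

lemma card_triples:
  fixes K :: "nat \<times> nat \<Rightarrow> nat set"
  assumes "0 < n" "\<And>p. finite (K p)"
  shows "card {(k, a, b). a * b = n \<and> k \<in> K (a, b)} = (\<Sum>b | b dvd n. card (K (n div b, b)))"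
proof -
  let ?D = "{(a, b). a * b = n}"
  have "{(k, a, b). a * b = n \<and> k \<in> K (a, b)} = prod.swap ` (SIGMA p:?D. K p)"
    by (auto simp: image_iff)
  then have "card {(k, a, b). a * b = n \<and> k \<in> K (a, b)} = card (SIGMA p:?D. K p)"
    by (simp add: card_image)
  also have "\<dots> = (\<Sum>p\<in>?D. card (K p))"
    using assms finite_divisor_pairs by (intro card_SigmaI) auto
  finally show ?thesis using sum_divisor_pairs[OF assms(1)] by simp
qed

text \<open>For \<open>j = k - 1\<close> one has \<open>j * j \<le> k * (k - 1) < a\<close>, so for
  each divisor there are fewer than \<open>sqrt a\<close> values of \<open>k\<close>.\<close>

lemma card_C_pairs_le:
  assumes "0 < n"
  shows "real (card (C_pairs n)) \<le> (\<Sum>b | b dvd n. sqrt (real (n div b)))"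
proof -
  let ?K = "\<lambda>(a::nat, b::nat). {k::nat. 2 \<le> k \<and> k * (k - 1) < a}"
  have sub: "?K (a, b) \<subseteq> Suc ` {j. 0 < j \<and> j * j < a}" for a b
  proof
    fix k assume k: "k \<in> ?K (a, b)"
    then obtain j where "k = Suc j" "0 < j" by (cases k) auto
    then show "k \<in> Suc ` {j. 0 < j \<and> j * j < a}" using k by auto
  qed
  have fin: "finite (?K p)" for p
  proof -
    have "finite (?K (fst p, snd p))"
      by (rule finite_subset[OF sub finite_imageI[OF finite_squares_below]])
    then show ?thesis by simp
  qed
  have cle: "card (?K (a, b)) \<le> card {j. 0 < j \<and> j * j < a}" for a b
  proof -
    have "card (?K (a, b)) \<le> card (Suc ` {j. 0 < j \<and> j * j < a})"
      by (rule card_mono[OF finite_imageI[OF finite_squares_below] sub])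
    then show ?thesis by (simp add: card_image)
  qed
  then have le: "real (card (?K (n div b, b))) \<le> sqrt (real (n div b))" if "b dvd n" for b
  proof -
    have "0 < n div b" using assms that by (auto simp: dvd_div_eq_0_iff intro: Nat.gr0I)
    from card_squares_below[OF this] show ?thesis
      using cle[of "n div b" b] by linarith
  qed
  have "C_pairs n = {(k, a, b). a * b = n \<and> k \<in> ?K (a, b)}"
    by (auto simp: C_pairs_def)
  then have "real (card (C_pairs n)) = (\<Sum>b | b dvd n. real (card (?K (n div b, b))))"
    using card_triples[OF assms, of ?K, OF fin] by simp
  also have "\<dots> \<le> (\<Sum>b | b dvd n. sqrt (real (n div b)))"
    using le by (intro sum_mono) auto
  finally show ?thesis .
qed

text \<open>Excluding \<open>y = 1\<close> saves one value for each divisor pair.\<close>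

lemma card_D_pairs_le:
  assumes "0 < n"
  shows "real (card (D_pairs n)) \<le> (\<Sum>b | b dvd n. sqrt (real (n div b)) - 1)"
proof -
  let ?K = "\<lambda>(a::nat, b::nat). {y::nat. 2 \<le> y \<and> y * y < a \<and> (odd a \<or> odd y)}"
  have sub: "?K (a, b) \<subseteq> {j. 0 < j \<and> j * j < a} - {1}" for a b
    by auto
  have fin: "finite (?K p)" for p
  proof -
    have "finite (?K (fst p, snd p))"
      by (rule finite_subset[OF sub finite_Diff[OF finite_squares_below]])
    then show ?thesis by simp
  qed
  have le: "real (card (?K (n div b, b))) \<le> sqrt (real (n div b)) - 1" if "b dvd n" for b
  proof -
    let ?a = "n div b" and ?S = "{j::nat. 0 < j \<and> j * j < n div b}"
    have a: "0 < ?a" using assms that by (auto simp: dvd_div_eq_0_iff intro: Nat.gr0I)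
    have "card (?K (?a, b)) \<le> card (?S - {1})"
      by (rule card_mono[OF finite_Diff[OF finite_squares_below] sub])
    show ?thesis
    \<comment> \<open>For \<open>a = 1\<close> the set \<open>?S\<close> is empty and 1 cannot be
      removed from it, but then the claimed bound is 0.\<close>
    proof (cases "?a = 1")
      case True
      have "?K (?a, b) = {}" unfolding True by auto
      then show ?thesis using True by simp
    next
      case False
      then have one: "1 \<in> ?S" using a by simp
      then have "card (?S - {1}) + 1 = card ?S"
        using card_Suc_Diff1[OF finite_squares_below one] by linarith
      then show ?thesis
        using \<open>card (?K (?a, b)) \<le> card (?S - {1})\<close> card_squares_below[OF a] by linarith
    qed
  qed
  have "D_pairs n = {(k, a, b). a * b = n \<and> k \<in> ?K (a, b)}"
    by (auto simp: D_pairs_def)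
  then have "real (card (D_pairs n)) = (\<Sum>b | b dvd n. real (card (?K (n div b, b))))"
    using card_triples[OF assms, of ?K, OF fin] by simp
  also have "\<dots> \<le> (\<Sum>b | b dvd n. sqrt (real (n div b)) - 1)"
    using le by (intro sum_mono) auto
  finally show ?thesis .
qed

text \<open>Telescoping: with \<open>u\<close>, \<open>v\<close> the roots of consecutive integers,
  \<open>1 = (v - u) * (v + u) \<le> (v - u) * 2 * v\<close>, so
  \<open>1 / v \<le> 2 * (v - u)\<close>.\<close>

lemma sum_inverse_sqrt_le:
  "(\<Sum>b=1..Suc m. 1 / sqrt (real b)) \<le> 2 * sqrt (real (Suc m)) - 1"
proof (induction m)
  case (Suc m)
  let ?u = "sqrt (real (Suc m))" and ?v = "sqrt (real (Suc (Suc m)))"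
  have v: "?u \<le> ?v" "0 < ?v" "?v * ?v - ?u * ?u = 1" by simp_all
  then have "1 \<le> (?v - ?u) * (2 * ?v)"
    using mult_left_mono[of "?v + ?u" "2 * ?v" "?v - ?u"] by (simp add: algebra_simps)
  then have "1 / ?v \<le> 2 * (?v - ?u)"
    using v(2) by (simp only: pos_divide_le_eq mult_ac)
  then have "1 / ?v \<le> 2 * ?v - 2 * ?u" by argo
  moreover have "(\<Sum>b=1..Suc (Suc m). 1 / sqrt (real b)) = (\<Sum>b=1..Suc m. 1 / sqrt (real b)) + 1 / ?v"
    by (simp only: sum.cl_ivl_Suc) simp
  ultimately show ?case using Suc by linarith
qed simp

text \<open>Yields \<open>\<Sum> 2 sqrt (n / b) \<le> sqrt n (d(n) / 3 + 10)\<close> over the divisors \<open>b\<close> of \<open>n\<close>; only the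
  terms with \<open>b \<le> 36\<close> are nonnegative.\<close>

lemma sum_inverse_sqrt_excess:
  assumes "finite S" "\<And>b. b \<in> S \<Longrightarrow> 0 < b"
  shows "(\<Sum>b\<in>S. 2 / sqrt (real b) - 1 / 3) \<le> 10"
proof -
  let ?h = "\<lambda>b. 2 / sqrt (real b) - 1 / 3"
  have s36: "sqrt 36 = (6::real)" by (rule real_sqrt_unique) auto
  have neg: "?h b \<le> 0" if "b > 36" for b
  proof -
    have "sqrt 36 \<le> sqrt (real b)" using that by (intro real_sqrt_le_mono) simp
    then show ?thesis unfolding s36 by (simp add: divide_simps)
  qed
  have pos: "0 \<le> ?h b" if "0 < b" "b \<le> 36" for b
  proof -
    have "sqrt (real b) \<le> sqrt 36" using that by (intro real_sqrt_le_mono) simp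
    then show ?thesis using that unfolding s36 by (simp add: divide_simps)
  qed
  have "(\<Sum>b\<in>S. ?h b) = (\<Sum>b\<in>S \<inter> {..36}. ?h b) + (\<Sum>b\<in>S - {..36}. ?h b)"
    using assms(1) by (rule sum.Int_Diff)
  also have "(\<Sum>b\<in>S - {..36}. ?h b) \<le> 0"
    using neg by (intro sum_nonpos) auto
  also have "(\<Sum>b\<in>S \<inter> {..36}. ?h b) \<le> (\<Sum>b=1..Suc 35. ?h b)"
    using assms pos by (intro sum_mono2) (auto simp: Suc_le_eq)
  \<comment> \<open>The 36 terms \<open>1 / 3\<close> add up to 12, and
    \<open>2 * (2 * 6 - 1) - 12 = 10\<close>.\<close>
  also have "\<dots> = 2 * (\<Sum>b=1..Suc 35. 1 / sqrt (real b)) - 12"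
    by (simp add: sum_subtractf sum_distrib_left)
  also have "\<dots> \<le> 10" using sum_inverse_sqrt_le[of 35] s36 by simp
  finally show ?thesis by simp
qed

definition divs :: "nat \<Rightarrow> nat" where "divs n = card {b. b dvd n}"

definition odd_divs :: "nat \<Rightarrow> nat" where "odd_divs n = card {b. b dvd n \<and> odd b}"

text \<open>An odd \<open>X\<close> may occur with every divisor \<open>b\<close>, an even
  \<open>X\<close> only with odd \<open>b\<close>. Let \<open>o\<close> odd and \<open>e\<close>
  even values of \<open>X\<close> occur, and let \<open>d\<close> and \<open>d'\<close> be the
  numbers of divisors and odd divisors. Then \<open>2 * (o * d + e * d')\<close> exceeds
  \<open>(o + e) * (d + d')\<close> by \<open>(o - e) * (d - d')\<close>, where \<open>o - e\<close>
  is at most 1.\<close>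

lemma card_parity_pairs_le:
  assumes "0 < n"
  defines "P \<equiv> {(X, a, b). 0 < X \<and> X * X < n \<and> a * b = n \<and> (odd X \<or> odd b)}"
  shows "finite P"
    and "2 * card P \<le> card {X. 0 < X \<and> X * X < n} * (divs n + odd_divs n) + divs n"
proof -
  let ?S = "{X::nat. 0 < X \<and> X * X < n}"
  let ?O = "{X \<in> ?S. odd X}" and ?E = "{X \<in> ?S. even X}"
  have finO: "finite ?O" and finE: "finite ?E"
    by (rule finite_subset[OF _ finite_squares_below[of n]]; blast)+
  have disj: "?O \<inter> ?E = {}" by blast
  have S: "card ?S = card ?O + card ?E"
  proof -
    have "?S = ?O \<union> ?E" by blast
    then show ?thesis
      using card_Un_disjoint[of ?O ?E] finO finE by (metis (no_types, lifting) disj)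
  qed
  \<comment> \<open>Every odd element other than 1 has an even predecessor in the set, so the odd
    elements outnumber the even ones by at most one.\<close>
  have "?O - {1} \<subseteq> Suc ` ?E"
  proof
    fix X assume X: "X \<in> ?O - {1}"
    then obtain Z where Z: "X = Suc Z" "0 < Z" "even Z" by (cases X) auto
    moreover have "Z * Z \<le> X * X" using Z by (intro mult_le_mono) auto
    ultimately show "X \<in> Suc ` ?E" using X by auto
  qed
  then have "card (?O - {1}) \<le> card ?E"
    using card_mono[OF finite_imageI[OF finE]] card_image_le[OF finE] le_trans by blast
  then have O: "card ?O \<le> card ?E + 1"
    using card_Diff_singleton_if[of ?O 1] by (simp split: if_splits)
  have odd_le: "odd_divs n \<le> divs n"
    unfolding odd_divs_def divs_def using assms by (intro card_mono) auto
  have P: "P \<subseteq> (\<lambda>(X, b). (X, n div b, b)) ` (?O \<times> {b. b dvd n} \<union> ?E \<times> {b. b dvd n \<and> odd b})"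
  proof
    fix t assume "t \<in> P"
    then obtain X a b where t: "t = (X, a, b)" "X \<in> ?S" "a * b = n" "odd X \<or> odd b"
      unfolding P_def by blast
    then have "0 < b" using assms(1) by (auto intro: Nat.gr0I)
    then have "n div b = a" unfolding t(3)[symmetric] by simp
    moreover have "b dvd n" using t(3) by (metis dvd_triv_right)
    ultimately show "t \<in> (\<lambda>(X, b). (X, n div b, b)) ` (?O \<times> {b. b dvd n} \<union> ?E \<times> {b. b dvd n \<and> odd b})"
      using t by (intro image_eqI[of _ _ "(X, b)"]) auto
  qed
  have fin: "finite (?O \<times> {b. b dvd n} \<union> ?E \<times> {b. b dvd n \<and> odd b})"
    using finO finE assms(1) by (intro finite_UnI finite_cartesian_product) simp_all
  then show "finite P" using P finite_imageI finite_subset by blast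
  have "card P \<le> card (?O \<times> {b. b dvd n} \<union> ?E \<times> {b. b dvd n \<and> odd b})"
    using card_mono[OF finite_imageI[OF fin] P] card_image_le[OF fin] le_trans by blast
  also have "\<dots> \<le> card (?O \<times> {b. b dvd n}) + card (?E \<times> {b. b dvd n \<and> odd b})"
    by (rule card_Un_le)
  also have "\<dots> = card ?O * divs n + card ?E * odd_divs n"
    by (simp add: card_cartesian_product divs_def odd_divs_def)
  finally have "card P \<le> card ?O * divs n + card ?E * odd_divs n" .
  then have "2 * card P \<le> 2 * (card ?O * divs n + card ?E * odd_divs n)" by (rule mult_le_mono2)
  also obtain c where c: "divs n = odd_divs n + c" using odd_le le_Suc_ex by blast
  have "card ?O * c \<le> (card ?E + 1) * c" using O by (rule mult_le_mono1)
  then have "2 * (card ?O * divs n + card ?E * odd_divs n)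
      \<le> (card ?O + card ?E) * (divs n + odd_divs n) + divs n"
    unfolding c by (simp add: algebra_simps)
  finally show "2 * card P \<le> card ?S * (divs n + odd_divs n) + divs n"
    unfolding S .
qed

lemma f_less_if_few_divisors:
  assumes "0 < n" and few: "(4 * divs n + 3 * odd_divs n + 30)\<^sup>2 \<le> 9 * n"
  shows "f n < n"
proof -
  let ?P = "{(X, a, b). 0 < X \<and> X * X < n \<and> a * b = n \<and> (odd X \<or> odd b)}"
  let ?r = "sqrt (real n)" and ?s = "card {X. 0 < X \<and> X * X < n}"
  let ?d = "real (divs n)" and ?o = "real (odd_divs n)"
  have d1: "1 \<le> divs n"
    unfolding divs_def using assms(1) by (simp add: Suc_le_eq card_gt_0_iff) (use one_dvd in blast)
  have "A_pairs n \<subseteq> ?P" "B_pairs n \<subseteq> ?P" by (auto simp: A_pairs_def B_pairs_def)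
  then have "card (A_pairs n) \<le> card ?P" "card (B_pairs n) \<le> card ?P"
    using card_parity_pairs_le(1)[OF assms(1)] by (auto intro: card_mono)
  then have "card (A_pairs n) + card (B_pairs n) \<le> ?s * (divs n + odd_divs n) + divs n"
    using card_parity_pairs_le(2)[OF assms(1)] by linarith
  then have "real (card (A_pairs n) + card (B_pairs n)) \<le> real (?s * (divs n + odd_divs n) + divs n)"
    by (simp only: of_nat_le_iff)
  then have AB: "real (card (A_pairs n)) + real (card (B_pairs n)) \<le> real ?s * (?d + ?o) + ?d"
    by simp
  have "real ?s * (?d + ?o) < ?r * (?d + ?o)"
    using card_squares_below[OF assms(1)] d1 by (intro mult_strict_right_mono) auto
  note AB = AB this
  have sq: "sqrt (real (n div b)) = ?r / sqrt (real b)" if "b dvd n" for b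
    using that by (simp add: real_of_nat_div real_sqrt_divide)
  have "real (card (C_pairs n)) + real (card (D_pairs n))
      \<le> (\<Sum>b | b dvd n. sqrt (real (n div b))) + (\<Sum>b | b dvd n. sqrt (real (n div b)) - 1)"
    using card_C_pairs_le[OF assms(1)] card_D_pairs_le[OF assms(1)] by linarith
  also have "\<dots> = (\<Sum>b | b dvd n. 2 * (?r / sqrt (real b)) - 1)"
    unfolding sum.distrib[symmetric] by (intro sum.cong) (auto simp: sq)
  also have "\<dots> = (\<Sum>b | b dvd n. ?r * (2 / sqrt (real b) - 1 / 3) + (?r / 3 - 1))"
    by (intro sum.cong) (auto simp: algebra_simps)
  also have "\<dots> = ?r * (\<Sum>b | b dvd n. 2 / sqrt (real b) - 1 / 3) + ?d * (?r / 3 - 1)"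
    by (simp add: sum.distrib sum_distrib_left divs_def)
  also have "\<dots> \<le> ?r * 10 + ?d * (?r / 3 - 1)"
    using assms(1) by (intro add_right_mono mult_left_mono sum_inverse_sqrt_excess) (auto intro: dvd_pos_nat)
  finally have CD: "real (card (C_pairs n)) + real (card (D_pairs n)) \<le> ?r * 10 + ?d * (?r / 3 - 1)" .
  have "real (f n) \<le> real (card (A_pairs n) + card (B_pairs n) + card (C_pairs n) + card (D_pairs n))"
    using f_le_pairs[OF assms(1)] by (simp only: of_nat_le_iff)
  then have "real (f n) < ?r * (?d + ?o) + ?d + (?r * 10 + ?d * (?r / 3 - 1))"
    using AB CD by simp
  \<comment> \<open>The surplus \<open>?d\<close> from the parity count cancels against the one
    saved per divisor in \<open>card_D_pairs_le\<close>.\<close>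
  also have "\<dots> = ?r * ((4 * ?d + 3 * ?o + 30) / 3)"
    by (simp add: field_simps)
  also have "\<dots> \<le> ?r * ?r"
  proof (rule mult_left_mono)
    have "real ((4 * divs n + 3 * odd_divs n + 30)\<^sup>2) \<le> real (9 * n)"
      using few by (simp only: of_nat_le_iff)
    then have "(4 * ?d + 3 * ?o + 30)\<^sup>2 \<le> (3 * ?r)\<^sup>2"
      by (simp add: power_mult_distrib)
    then have "4 * ?d + 3 * ?o + 30 \<le> 3 * ?r"
      by (rule power2_le_imp_le) simp
    then show "(4 * ?d + 3 * ?o + 30) / 3 \<le> ?r" by simp
  qed simp
  also have "\<dots> = real n" by simp
  finally show ?thesis by simp
qed

section \<open>Numbers with many divisors\<close>

lemma divs_prime_power_mult_le:
  assumes "prime p" "0 < m"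
  shows "divs (p ^ e * m) \<le> (e + 1) * divs m"
proof -
  have fin: "finite ({..e} \<times> {b. b dvd m})" using assms by simp
  have "{b. b dvd p ^ e * m} \<subseteq> (\<lambda>(i, c). p ^ i * c) ` ({..e} \<times> {b. b dvd m})"
  proof
    fix b assume "b \<in> {b. b dvd p ^ e * m}"
    then obtain q c where q: "b = q * c" "q dvd p ^ e" "c dvd m"
      using division_decomp by blast
    obtain i where "i \<le> e" "q = p ^ i"
      using q(2) assms(1) by (auto simp: divides_primepow_nat)
    then show "b \<in> (\<lambda>(i, c). p ^ i * c) ` ({..e} \<times> {b. b dvd m})"
      using q by (intro image_eqI[of _ _ "(i, c)"]) auto
  qed
  then have "divs (p ^ e * m) \<le> card ({..e} \<times> {b. b dvd m})"
    unfolding divs_def using card_mono[OF finite_imageI[OF fin]] card_image_le[OF fin] le_trans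
    by blast
  then show ?thesis by (simp add: card_cartesian_product divs_def)
qed

lemma odd_divs_power2_mult_le:
  assumes "0 < m"
  shows "odd_divs (2 ^ e * m) \<le> divs m"
proof -
  have "{b. b dvd 2 ^ e * m \<and> odd b} \<subseteq> {b. b dvd m}"
  proof
    fix b assume b: "b \<in> {b. b dvd 2 ^ e * m \<and> odd b}"
    then have "coprime b (2 ^ e)" by simp
    then show "b \<in> {b. b dvd m}" using b by (simp add: coprime_dvd_mult_right_iff)
  qed
  then show ?thesis unfolding odd_divs_def divs_def using assms by (intro card_mono) auto
qed

text \<open>Here \<open>t\<close> is the number of prime factors with multiplicity: splitting off a
  prime divides \<open>m\<close> by at least 11 and at most halves the number of divisors.\<close>

lemma rough_divs_le:
  assumes "0 < m" "\<And>p. prime p \<Longrightarrow> p dvd m \<Longrightarrow> 11 \<le> p"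
  shows "\<exists>t. 11 ^ t \<le> m \<and> divs m \<le> 2 ^ t"
  using assms
proof (induction m rule: less_induct)
  case (less m)
  show ?case
  proof (cases "m = 1")
    case True
    have "{b. b dvd m} = {1}" using True by auto
    then have "divs m = 1" unfolding divs_def by simp
    then show ?thesis using True by (intro exI[of _ 0]) simp
  next
    case False
    then obtain p where p: "prime p" "p dvd m" using prime_factor_nat by blast
    then obtain c where c: "m = p * c" by (auto simp: dvd_def)
    have p11: "11 \<le> p" using less.prems(2) p by blast
    have "0 < c" using less.prems(1) c by (auto intro: Nat.gr0I)
    moreover have "c < m" using \<open>0 < c\<close> p11 c by simp
    moreover have "11 \<le> q" if "prime q" "q dvd c" for q
      using less.prems(2)[OF that(1)] that(2) c by simp
    ultimately obtain t where t: "11 ^ t \<le> c" "divs c \<le> 2 ^ t"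
      using less.IH[of c] by blast
    have "11 ^ Suc t \<le> m" unfolding c power_Suc using p11 t(1) by (rule mult_le_mono)
    moreover have "divs m \<le> 2 ^ Suc t"
      using divs_prime_power_mult_le[OF p(1) \<open>0 < c\<close>, of 1] t(2) unfolding c by simp
    ultimately show ?thesis by blast
  qed
qed

lemma prime_power_decomposition:
  assumes "prime p" "0 < (n::nat)"
  obtains e m where "n = p ^ e * m" "0 < m" "\<not> p dvd m"
proof -
  have "n \<noteq> 0" "\<not> is_unit p" using assms by auto
  then obtain m where m: "n = p ^ multiplicity p n * m" "\<not> p dvd m"
    by (rule multiplicity_decompose')
  then have "0 < m" by (auto intro: Nat.gr0I)
  then show thesis using that m by blast
qed

section \<open>Exponents for which the divisor bound can fail\<close>

definition smooth :: "nat \<Rightarrow> nat \<Rightarrow> nat \<Rightarrow> nat \<Rightarrow> nat" where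
  "smooth e i j k = 2 ^ e * (3 ^ i * (5 ^ j * 7 ^ k))"

text \<open>This is \<open>4 (e + 1) F + 3 F + 30\<close> for \<open>F = (i + 1) (j + 1) (k + 1) 2\<^sup>t\<close>, which bounds the number of
  odd divisors of \<open>smooth e i j k * m\<close> when \<open>m\<close> has \<open>t\<close> prime factors, all at least 11.\<close>

definition weight :: "nat \<Rightarrow> nat \<Rightarrow> nat \<Rightarrow> nat \<Rightarrow> nat \<Rightarrow> nat" where
  "weight e i j k t = (i + 1) * ((j + 1) * ((k + 1) * 2 ^ t)) * (4 * e + 7) + 30"

definition light :: "nat \<Rightarrow> nat \<Rightarrow> nat \<Rightarrow> nat \<Rightarrow> nat \<Rightarrow> bool" where
  "light e i j k t \<longleftrightarrow> (weight e i j k t)\<^sup>2 \<le> 9 * (smooth e i j k * 11 ^ t)"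

text \<open>If the weight grows by a factor of at most \<open>q / p\<close> while the other side is
  multiplied by \<open>r\<close>, the inequality persists as soon as
  \<open>(q / p)\<^sup>2 \<le> r\<close>.\<close>

lemma square_step:
  fixes w w' s :: nat
  assumes "w\<^sup>2 \<le> s" "p * w' \<le> q * w" "q\<^sup>2 \<le> r * p\<^sup>2" "0 < p"
  shows "w'\<^sup>2 \<le> r * s"
proof -
  have "p\<^sup>2 * w'\<^sup>2 = (p * w')\<^sup>2" by (simp add: power_mult_distrib)
  also have "\<dots> \<le> (q * w)\<^sup>2" using assms(2) by (rule power_mono) simp
  also have "\<dots> = q\<^sup>2 * w\<^sup>2" by (simp add: power_mult_distrib)
  also have "\<dots> \<le> (r * p\<^sup>2) * s" using assms(3,1) by (rule mult_le_mono)
  also have "\<dots> = p\<^sup>2 * (r * s)" by (simp add: mult_ac)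
  finally show ?thesis using assms(4) by simp
qed

text \<open>For \<open>e = 0\<close> and \<open>i = 0\<close> the square of the weight may grow faster than the power of 2 or 3.\<close>

lemma light_Suc:
  assumes "light e i j k t"
  shows "1 \<le> e \<Longrightarrow> light (Suc e) i j k t" "1 \<le> i \<Longrightarrow> light e (Suc i) j k t"
    "light e i (Suc j) k t" "light e i j (Suc k) t" "light e i j k (Suc t)"
proof -
  let ?s = "9 * (smooth e i j k * 11 ^ t)"
  have l: "(weight e i j k t)\<^sup>2 \<le> ?s" using assms by (simp add: light_def)
  show "light (Suc e) i j k t" if "1 \<le> e"
  proof -
    define F where "F = (i + 1) * ((j + 1) * ((k + 1) * 2 ^ t))"
    have "F * 1 \<le> F * e" using that by (intro mult_le_mono2)
    moreover have "weight (Suc e) i j k t = 4 * (F * e) + 11 * F + 30"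
      "weight e i j k t = 4 * (F * e) + 7 * F + 30"
      unfolding weight_def F_def[symmetric] by (simp_all add: algebra_simps)
    \<comment> \<open>The ratio of the weights is largest for \<open>e = 1\<close>, where it is
      below \<open>15 * F / (11 * F)\<close>; and
      \<open>15 * 15 = 225 \<le> 242 = 2 * 11 * 11\<close>.\<close>
    ultimately have "11 * weight (Suc e) i j k t \<le> 15 * weight e i j k t" by linarith
    from square_step[OF l this, of 2] show ?thesis
      unfolding light_def smooth_def by (simp add: mult_ac)
  qed
  show "light e (Suc i) j k t" if "1 \<le> i"
  proof -
    define F where "F = ((j + 1) * ((k + 1) * 2 ^ t)) * (4 * e + 7)"
    have w: "weight e i' j k t = (i' + 1) * F + 30" for i'
      unfolding weight_def F_def by (simp only: mult.assoc)
    have "F * 1 \<le> F * i" using that by (intro mult_le_mono2)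
    moreover have "weight e (Suc i) j k t = F * i + 2 * F + 30" "weight e i j k t = F * i + F + 30"
      unfolding w by (simp_all add: algebra_simps)
    ultimately have "2 * weight e (Suc i) j k t \<le> 3 * weight e i j k t" by linarith
    from square_step[OF l this, of 3] show ?thesis
      unfolding light_def smooth_def by (simp add: mult_ac)
  qed
  \<comment> \<open>For the remaining three parameters the weight at most doubles, and 4 is below
    each of 5, 7 and 11.\<close>
  have "1 * weight e i (Suc j) k t \<le> 2 * weight e i j k t"
  proof -
    define F where "F = (i + 1) * ((k + 1) * 2 ^ t) * (4 * e + 7)"
    have w: "weight e i j' k t = (j' + 1) * F + 30" for j'
      unfolding weight_def F_def by (simp only: mult_ac)
    show ?thesis unfolding w by (simp add: algebra_simps)
  qed
  from square_step[OF l this, of 5] show "light e i (Suc j) k t"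
    unfolding light_def smooth_def by (simp add: mult_ac)
  have "1 * weight e i j (Suc k) t \<le> 2 * weight e i j k t"
  proof -
    define F where "F = (i + 1) * ((j + 1) * 2 ^ t) * (4 * e + 7)"
    have w: "weight e i j k' t = (k' + 1) * F + 30" for k'
      unfolding weight_def F_def by (simp only: mult_ac)
    show ?thesis unfolding w by (simp add: algebra_simps)
  qed
  from square_step[OF l this, of 7] show "light e i j (Suc k) t"
    unfolding light_def smooth_def by (simp add: mult_ac)
  have "1 * weight e i j k (Suc t) \<le> 2 * weight e i j k t"
  proof -
    define F where "F = (i + 1) * ((j + 1) * (k + 1)) * (4 * e + 7)"
    have w: "weight e i j k t' = 2 ^ t' * F + 30" for t'
      unfolding weight_def F_def by (simp only: mult_ac)
    show ?thesis unfolding w by (simp add: algebra_simps)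
  qed
  from square_step[OF l this, of 11] show "light e i j k (Suc t)"
    unfolding light_def by (simp add: mult_ac)
qed

text \<open>Iterates \<open>light_Suc\<close>. The last two assumptions ensure that no step raises
  \<open>e\<close> or \<open>i\<close> from 0.\<close>

lemma light_mono:
  assumes "light e0 i0 j0 k0 t0" "e0 \<le> e" "i0 \<le> i" "j0 \<le> j" "k0 \<le> k" "t0 \<le> t"
    and "e0 = e \<or> 1 \<le> e0" "i0 = i \<or> 1 \<le> i0"
  shows "light e i j k t"
proof -
  have 0: "light e i0 j0 k0 t0" using assms(2,7)
    by (induction e rule: dec_induct) (use assms(1) light_Suc(1) in auto)
  have 1: "light e i j0 k0 t0" using assms(3,8)
    by (induction i rule: dec_induct) (use 0 light_Suc(2) in auto)
  have 2: "light e i j k0 t0" using assms(4)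
    by (induction j rule: dec_induct) (use 1 light_Suc(3) in auto)
  have 3: "light e i j k t0" using assms(5)
    by (induction k rule: dec_induct) (use 2 light_Suc(4) in auto)
  show ?thesis using assms(6)
    by (induction t rule: dec_induct) (use 3 light_Suc(5) in auto)
qed

text \<open>Beyond any one of these bounds the tuple dominates a tuple that is already light. For
  \<open>e\<close> and \<open>i\<close> the dominated tuple has exponent 0 only if the given one
  has, as \<open>light_mono\<close> demands.\<close>

lemma heavy_bounds:
  assumes "\<not> light e i j k t"
  shows "e < 10" "i < 6" "j < 4" "k < 4" "t < 3"
proof -
  define e0 i0 where "e0 = (if e = 0 then 0 else 1::nat)" and "i0 = (if i = 0 then 0 else 1::nat)"
  have m: "e0 \<le> e" "i0 \<le> i" "e0 = e \<or> 1 \<le> e0" "i0 = i \<or> 1 \<le> i0"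
    by (auto simp: e0_def i0_def)
  have "light 10 i0 0 0 0" "light e0 6 0 0 0" "light e0 i0 4 0 0" "light e0 i0 0 4 0" "light e0 i0 0 0 3"
    by (auto simp: e0_def i0_def light_def weight_def smooth_def power2_eq_square)
  then show "e < 10" "i < 6" "j < 4" "k < 4" "t < 3"
    using assms m light_mono[of 10 i0 0 0 0 e i j k t] light_mono[of e0 6 0 0 0 e i j k t]
      light_mono[of e0 i0 4 0 0 e i j k t] light_mono[of e0 i0 0 4 0 e i j k t]
      light_mono[of e0 i0 0 0 3 e i j k t]
    by (auto simp: not_less[symmetric])
qed

lemma exceptional_cases:
  assumes "0 < n" "\<not> f n < n"
  obtains e i j k t m where "e < 10" "i < 6" "j < 4" "k < 4" "t < 3" "n = smooth e i j k * m"
    "11 ^ t \<le> m" "t = 0 \<longrightarrow> m = 1" "\<not> 2 dvd m" "\<not> 3 dvd m" "\<not> 5 dvd m" "\<not> 7 dvd m"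
    "9 * n < (weight e i j k t)\<^sup>2"
proof -
  obtain e m2 where 2: "n = 2 ^ e * m2" "0 < m2" "\<not> 2 dvd m2"
    using prime_power_decomposition[OF two_is_prime_nat assms(1)] .
  obtain i m3 where 3: "m2 = 3 ^ i * m3" "0 < m3" "\<not> 3 dvd m3"
    by (rule prime_power_decomposition[of 3, OF _ 2(2)]) simp_all
  obtain j m5 where 5: "m3 = 5 ^ j * m5" "0 < m5" "\<not> 5 dvd m5"
    by (rule prime_power_decomposition[of 5, OF _ 3(2)]) simp_all
  obtain k m where 7: "m5 = 7 ^ k * m" "0 < m" "\<not> 7 dvd m"
    by (rule prime_power_decomposition[of 7, OF _ 5(2)]) simp_all
  have nd: "\<not> 2 dvd m" "\<not> 3 dvd m" "\<not> 5 dvd m" "\<not> 7 dvd m"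
    using 2(3) 3(3) 5(3) 7(3) unfolding 3(1) 5(1) 7(1) by (metis dvd_mult)+
  have "11 \<le> p" if p: "prime p" "p dvd m" for p
  proof (rule ccontr)
    assume "\<not> 11 \<le> p"
    moreover have "p \<noteq> 2" "p \<noteq> 3" "p \<noteq> 5" "p \<noteq> 7" using p nd by auto
    ultimately have "p = 0 \<or> p = 1 \<or> p = 4 \<or> p = 6 \<or> p = 8 \<or> p = 9 \<or> p = 10" by presburger
    moreover have "\<not> prime (0::nat)" "\<not> prime (1::nat)" "\<not> prime (4::nat)" "\<not> prime (6::nat)"
      "\<not> prime (8::nat)" "\<not> prime (9::nat)" "\<not> prime (10::nat)"
      by simp_all
    ultimately show False using p(1) by metis
  qed
  then obtain t where t: "11 ^ t \<le> m" "divs m \<le> 2 ^ t" using rough_divs_le 7(2) by blast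
  have "divs m5 \<le> (k + 1) * divs m" "divs m3 \<le> (j + 1) * divs m5" "divs m2 \<le> (i + 1) * divs m3"
    "divs n \<le> (e + 1) * divs m2"
    unfolding 2(1) 3(1) 5(1) 7(1) using 2 3 5 7
    by (intro divs_prime_power_mult_le; simp)+
  then have "divs m5 \<le> (k + 1) * 2 ^ t" using t(2) mult_le_mono2 le_trans by blast
  then have "divs m3 \<le> (j + 1) * ((k + 1) * 2 ^ t)"
    using \<open>divs m3 \<le> (j + 1) * divs m5\<close> mult_le_mono2 le_trans by blast
  then have m2: "divs m2 \<le> (i + 1) * ((j + 1) * ((k + 1) * 2 ^ t))" (is "_ \<le> ?F")
    using \<open>divs m2 \<le> (i + 1) * divs m3\<close> mult_le_mono2 le_trans by blast
  then have d: "divs n \<le> (e + 1) * ?F"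
    using \<open>divs n \<le> (e + 1) * divs m2\<close> mult_le_mono2 le_trans by blast
  have o: "odd_divs n \<le> ?F" using odd_divs_power2_mult_le[OF 2(2)] m2 unfolding 2(1) by (rule le_trans)
  have "4 * divs n + 3 * odd_divs n + 30 \<le> 4 * ((e + 1) * ?F) + 3 * ?F + 30"
    using d o by (intro add_mono mult_le_mono2) auto
  also have "\<dots> = weight e i j k t" by (simp add: weight_def algebra_simps)
  finally have "(4 * divs n + 3 * odd_divs n + 30)\<^sup>2 \<le> (weight e i j k t)\<^sup>2"
    by (rule power_mono) simp
  moreover have "\<not> (4 * divs n + 3 * odd_divs n + 30)\<^sup>2 \<le> 9 * n"
    using f_less_if_few_divisors assms by blast
  ultimately have w: "9 * n < (weight e i j k t)\<^sup>2" by linarith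
  have n: "n = smooth e i j k * m" unfolding 2(1) 3(1) 5(1) 7(1) smooth_def by (simp only: mult.assoc)
  \<comment> \<open>Since \<open>11 ^ t \<le> m\<close>, failure of the bound for \<open>n\<close>
    is also failure for the smallest conceivable cofactor, so \<open>heavy_bounds\<close>
    applies.\<close>
  have "9 * (smooth e i j k * 11 ^ t) \<le> 9 * n" unfolding n using t(1) by (intro mult_le_mono2)
  then have "\<not> light e i j k t" using w unfolding light_def by linarith
  note b = heavy_bounds[OF this]
  have "m = 1" if "t = 0"
  proof (rule ccontr)
    assume "m \<noteq> 1"
    have "card {1, m} \<le> divs m" unfolding divs_def using 7(2) by (intro card_mono) auto
    then show False using t(2) that \<open>m \<noteq> 1\<close> by simp
  qed
  then show thesis using that b n t(1) nd w by blast
qed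

section \<open>Evaluation of the exceptional cases\<close>

text \<open>The functions below are run by the simplifier, which evaluates arguments but not the branches of
  a conditional. Hence conditionals replace conjunctions, and intermediate results are passed on as
  arguments of auxiliary constants. The seed \<open>r\<close> saves steps when the square roots of an increasing list
  are computed; if it is too large, the result is still an upper bound.\<close>

function ceil_sqrt :: "nat \<Rightarrow> nat \<Rightarrow> nat" where
  "ceil_sqrt r a = (if a \<le> r * r then r else ceil_sqrt (r + 1) a)"
  by auto
termination
proof (relation "measure (\<lambda>(r, a). a - r)")
  fix r a :: nat
  assume "\<not> a \<le> r * r"
  then have "r < a" using le_square[of r] by linarith
  then show "((r + 1, a), r, a) \<in> measure (\<lambda>(r, a). a - r)" by simp
qed simp

declare ceil_sqrt.simps [simp del]

lemma ceil_sqrt_le: "a \<le> ceil_sqrt r a * ceil_sqrt r a"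
proof (induction r a rule: ceil_sqrt.induct)
  case (1 r a)
  then show ?case by (subst (1 2) ceil_sqrt.simps) simp
qed

text \<open>For an increasing list \<open>D\<close> the first components increase along the result,
  so the square root of one entry can seed the next. The strict inequality in the second half keeps
  the square root of \<open>n\<close> from occurring twice.\<close>

definition divisor_list :: "nat \<Rightarrow> nat list \<Rightarrow> (nat \<times> nat) list" where
  "divisor_list n D = map (\<lambda>b. (b, n div b)) (filter (\<lambda>b. b * b \<le> n) D) @
     map (\<lambda>b. (n div b, b)) (rev (filter (\<lambda>b. b * b < n) D))"

lemma divisor_pairs_subset:
  assumes "0 < n" "n \<le> r * r"
  shows "{(a, b). a * b = n} \<subseteq> set (divisor_list n (filter (\<lambda>b. n mod b = 0) [1..<r + 1]))"
proof clarify
  fix a b assume ab: "n = a * b"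
  have pos: "0 < a" "0 < b" using assms(1) ab by auto
  have div: "n div a = b" "n div b = a" "n mod a = 0" "n mod b = 0" using ab pos by simp_all
  have small: "c \<le> r" if "c * c \<le> n" for c
  proof (rule ccontr)
    assume "\<not> c \<le> r"
    then have "r * r < c * c" by (intro mult_strict_mono) auto
    then show False using that assms(2) by linarith
  qed
  show "(a, b) \<in> set (divisor_list (a * b) (filter (\<lambda>ba. a * b mod ba = 0) [1..<r + 1]))"
    unfolding ab[symmetric]
  proof (cases "a \<le> b")
    case True
    then have "a * a \<le> n" unfolding ab by simp
    then have "a \<in> set (filter (\<lambda>b. b * b \<le> n) (filter (\<lambda>b. n mod b = 0) [1..<r + 1]))"
      using pos div small[of a] by (simp del: upt_Suc)
    then have "(a, n div a) \<in> set (map (\<lambda>b. (b, n div b)) (filter (\<lambda>b. b * b \<le> n) (filter (\<lambda>b. n mod b = 0) [1..<r + 1])))"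
      unfolding set_map by (rule imageI)
    then show "(a, b) \<in> set (divisor_list n (filter (\<lambda>b. n mod b = 0) [1..<r + 1]))"
      unfolding divisor_list_def div by (simp del: upt_Suc)
  next
    case False
    then have "b * b < n" unfolding ab using pos by simp
    then have "b \<in> set (rev (filter (\<lambda>b. b * b < n) (filter (\<lambda>b. n mod b = 0) [1..<r + 1])))"
      using pos div small[of b] by (simp del: upt_Suc)
    then have "(n div b, b) \<in> set (map (\<lambda>b. (n div b, b)) (rev (filter (\<lambda>b. b * b < n) (filter (\<lambda>b. n mod b = 0) [1..<r + 1]))))"
      unfolding set_map by (rule imageI)
    then show "(a, b) \<in> set (divisor_list n (filter (\<lambda>b. n mod b = 0) [1..<r + 1]))"
      unfolding divisor_list_def div by (simp del: upt_Suc)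
  qed
qed

section \<open>Computable bound for the third and fourth region\<close>

lemma sum_le_sum_list:
  fixes g :: "'a \<Rightarrow> nat"
  assumes "S \<subseteq> set L"
  shows "sum g S \<le> sum_list (map g L)"
proof -
  have "sum g S \<le> sum g (set L)" using assms by (intro sum_mono2) auto
  also have "\<dots> \<le> sum_list (map g L)"
  proof (induction L)
    case (Cons x L)
    have "sum g (set (x # L)) \<le> g x + sum g (set L)" by (simp add: sum.insert_if)
    then show ?case using Cons by simp
  qed simp
  finally show ?thesis .
qed

text \<open>The first component is the seed for the next entry. The summands are the sizes of
  \<open>{2..q}\<close> and of \<open>{2..<q}\<close>, the latter restricted to odd numbers when
  \<open>a\<close> is even.\<close>

definition tail_add :: "nat \<Rightarrow> nat \<Rightarrow> nat \<Rightarrow> nat \<times> nat" where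
  "tail_add a q c = (q, c + (q - 1) + (if a mod 2 = 0 then (q - 2) div 2 else q - 2))"

fun tail_count :: "(nat \<times> nat) list \<Rightarrow> nat \<times> nat \<Rightarrow> nat" where
  "tail_count [] (r, c) = c"
| "tail_count ((a, b) # L) (r, c) = tail_count L (tail_add a (ceil_sqrt r a) c)"

definition C_set :: "nat \<Rightarrow> nat set" where "C_set a = {k. 2 \<le> k \<and> k * (k - 1) < a}"

definition D_set :: "nat \<Rightarrow> nat set" where "D_set a = {y. 2 \<le> y \<and> y * y < a \<and> (odd a \<or> odd y)}"

lemma C_set_subset:
  assumes "a \<le> q * q"
  shows "C_set a \<subseteq> {2..q}"
proof
  fix k assume k: "k \<in> C_set a"
  have "k \<le> q"
  proof (rule ccontr)
    assume "\<not> k \<le> q"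
    then have "q * q \<le> k * (k - 1)" by (intro mult_le_mono) auto
    then show False using k assms by (simp add: C_set_def)
  qed
  then show "k \<in> {2..q}" using k by (simp add: C_set_def)
qed

lemma D_set_subset:
  assumes "a \<le> q * q"
  shows "D_set a \<subseteq> {2..<q}"
proof
  fix y assume y: "y \<in> D_set a"
  have "y < q"
  proof (rule ccontr)
    assume "\<not> y < q"
    then have "q * q \<le> y * y" by (intro mult_le_mono) auto
    then show False using y assms by (simp add: D_set_def)
  qed
  then show "y \<in> {2..<q}" using y by (simp add: D_set_def)
qed

lemma card_C_D_set_le:
  assumes "a \<le> q * q"
  shows "card (C_set a) + card (D_set a) \<le> (q - 1) + (if a mod 2 = 0 then (q - 2) div 2 else q - 2)"
proof -
  have "card (C_set a) \<le> q - 1"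
    using card_mono[OF _ C_set_subset[OF assms]] by simp
  moreover have "card (D_set a) \<le> (if a mod 2 = 0 then (q - 2) div 2 else q - 2)"
  proof (cases "a mod 2 = 0")
    case True
    have "D_set a \<subseteq> (\<lambda>i. 2 * i + 3) ` {..<(q - 2) div 2}"
    proof
      fix y assume y: "y \<in> D_set a"
      then have "odd y" using True by (auto simp: D_set_def)
      moreover have "2 \<le> y" "y < q" using D_set_subset[OF assms] y by auto
      ultimately have "y = 2 * ((y - 3) div 2) + 3" "(y - 3) div 2 < (q - 2) div 2"
        by presburger+
      then show "y \<in> (\<lambda>i. 2 * i + 3) ` {..<(q - 2) div 2}" by blast
    qed
    then have "card (D_set a) \<le> card ((\<lambda>i. 2 * i + 3) ` {..<(q - 2) div 2})"
      by (intro card_mono) auto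
    also have "\<dots> \<le> (q - 2) div 2" using card_image_le[of "{..<(q - 2) div 2}"] by simp
    finally show ?thesis using True by simp
  next
    case False
    then show ?thesis using card_mono[OF _ D_set_subset[OF assms]] by simp
  qed
  ultimately show ?thesis by linarith
qed

text \<open>Any seed is allowed, since \<open>ceil_sqrt\<close> returns an upper bound of the square
  root whatever the seed.\<close>

lemma tail_count_ge:
  "c + sum_list (map (\<lambda>(a, b). card (C_set a) + card (D_set a)) L) \<le> tail_count L (r, c)"
proof (induction L arbitrary: r c)
  case (Cons p L)
  obtain a b where p: "p = (a, b)" by (cases p)
  have "c + (card (C_set a) + card (D_set a)) + sum_list (map (\<lambda>(a, b). card (C_set a) + card (D_set a)) L)
      \<le> snd (tail_add a (ceil_sqrt r a) c) + sum_list (map (\<lambda>(a, b). card (C_set a) + card (D_set a)) L)"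
    using card_C_D_set_le[OF ceil_sqrt_le[of a r]] unfolding tail_add_def snd_conv by linarith
  also have "\<dots> \<le> tail_count L (fst (tail_add a (ceil_sqrt r a) c), snd (tail_add a (ceil_sqrt r a) c))"
    by (rule Cons.IH)
  finally show ?case unfolding p by simp
qed simp

lemma card_C_D_pairs_le:
  assumes "0 < n" "{(a, b). a * b = n} \<subseteq> set L"
  shows "card (C_pairs n) + card (D_pairs n) \<le> tail_count L (r, 0)"
proof -
  have finC: "finite (C_set (fst p))" for p :: "nat \<times> nat"
    using finite_subset[OF C_set_subset[OF ceil_sqrt_le]] by blast
  have finD: "finite (D_set (fst p))" for p :: "nat \<times> nat"
    using finite_subset[OF D_set_subset[OF ceil_sqrt_le]] by blast
  have "C_pairs n = {(k, a, b). a * b = n \<and> k \<in> C_set (fst (a, b))}"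
    by (auto simp: C_pairs_def C_set_def)
  then have C: "card (C_pairs n) = (\<Sum>b | b dvd n. card (C_set (n div b)))"
    using card_triples[OF assms(1), of "\<lambda>p. C_set (fst p)", OF finC] by simp
  have "D_pairs n = {(k, a, b). a * b = n \<and> k \<in> D_set (fst (a, b))}"
    by (auto simp: D_pairs_def D_set_def)
  then have D: "card (D_pairs n) = (\<Sum>b | b dvd n. card (D_set (n div b)))"
    using card_triples[OF assms(1), of "\<lambda>p. D_set (fst p)", OF finD] by simp
  have "card (C_pairs n) + card (D_pairs n)
      = (\<Sum>p\<in>{(a, b). a * b = n}. (\<lambda>(a, b). card (C_set a) + card (D_set a)) p)"
    unfolding C D sum_divisor_pairs[OF assms(1)] by (simp add: sum.distrib)
  also have "\<dots> \<le> sum_list (map (\<lambda>(a, b). card (C_set a) + card (D_set a)) L)"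
    by (rule sum_le_sum_list[OF assms(2)])
  also have "\<dots> \<le> tail_count L (r, 0)" using tail_count_ge[of 0 L r] by simp
  finally show ?thesis .
qed

section \<open>Computable bound for the first and second region\<close>

fun row :: "nat \<Rightarrow> nat \<Rightarrow> nat \<Rightarrow> (nat \<times> nat) list \<Rightarrow> nat" where
  "row n X k [] = 0"
| "row n X k ((a, b) # L) = (if (a + X) mod k = 0 then 1 else 0) +
     (if b * X < n then if 2 < b then if (X + 1) * (2 * X + 1) \<le> n + b * X then 1 else 0 else 0 else 0) +
     row n X k L"

text \<open>Runs \<open>X\<close> downwards, where the second condition in \<^const>\<open>row\<close> is most restrictive, and stops as
  soon as the trivial bound for the remaining rows suffices.\<close>

function rows :: "nat \<Rightarrow> (nat \<times> nat) list \<Rightarrow> (nat \<times> nat) list \<Rightarrow> nat \<Rightarrow> nat \<Rightarrow> nat \<Rightarrow> nat \<Rightarrow> bool" where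
  "rows n L M l m X c =
     (if c + 2 * ((X + 1) div 2 * l + X div 2 * m) < n then True
      else if X = 0 then False
      else rows n L M l m (X - 1) (c + row n X (least_residue n X) (if X mod 2 = 0 then M else L)))"
  by auto
termination by (relation "measure (\<lambda>(n, L, M, l, m, X, c). X)") auto

declare rows.simps [simp del]

definition A_row :: "nat \<Rightarrow> nat \<Rightarrow> (nat \<times> nat) set" where
  "A_row n X = {(a, b). (X, a, b) \<in> A_pairs n}"

definition B_row :: "nat \<Rightarrow> nat \<Rightarrow> (nat \<times> nat) set" where
  "B_row n X = {(a, b). (X, a, b) \<in> B_pairs n}"

lemma card_subset_filter:
  assumes "S \<subseteq> set L" "\<And>p. p \<in> S \<Longrightarrow> P p"
  shows "card S \<le> length (filter P L)"
proof -
  have "S \<subseteq> set (filter P L)" using assms by auto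
  then have "card S \<le> card (set (filter P L))" by (intro card_mono) auto
  also have "\<dots> \<le> length (filter P L)" by (rule card_length)
  finally show ?thesis .
qed

text \<open>With \<open>k = least_residue n X\<close> the two counts bound the sizes of
  \<open>A_row n X\<close> and \<open>B_row n X\<close>.\<close>

lemma row_eq:
  "row n X k L = length (filter (\<lambda>(a, b). k dvd a + X) L) +
     length (filter (\<lambda>(a, b). b * X < n \<and> 2 < b \<and> (X + 1) * (2 * X + 1) \<le> n + b * X) L)"
proof (induction L)
  case (Cons p L)
  obtain a b where p: "p = (a, b)" by (cases p)
  have nested: "(if P then if Q then if R then 1 else 0 else 0 else 0) = (if P \<and> Q \<and> R then 1 else 0 :: nat)" for P Q R
    by simp
  show ?case
    unfolding p row.simps nested Cons filter.simps prod.case mod_eq_0_iff_dvd by simp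
qed simp

text \<open>\<open>L\<close> serves odd \<open>X\<close> and \<open>M\<close> even \<open>X\<close>,
  because an even \<open>X\<close> forces \<open>b\<close> to be odd. The argument \<open>c\<close>
  accumulates what has been counted so far, starting from the bound for the other two
  regions.\<close>

lemma rows_bound:
  assumes L: "{(a, b). a * b = n} \<subseteq> set L" "{(a, b). a * b = n \<and> odd b} \<subseteq> set M"
    and "rows n L M (length L) (length M) X c"
  shows "c + (\<Sum>Z=1..X. card (A_row n Z) + card (B_row n Z)) < n"
  using assms(3)
proof (induction X arbitrary: c)
  have sub: "A_row n X \<subseteq> set (if X mod 2 = 0 then M else L)" "B_row n X \<subseteq> set (if X mod 2 = 0 then M else L)" for X
    using L by (auto simp: A_row_def B_row_def A_pairs_def B_pairs_def)
  have triv: "card (A_row n X) + card (B_row n X) \<le> 2 * length (if X mod 2 = 0 then M else L)" for X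
    using card_subset_filter[OF sub(1)[of X], of "\<lambda>_. True"] card_subset_filter[OF sub(2)[of X], of "\<lambda>_. True"]
    by (simp del: if_split)
  \<comment> \<open>Up to \<open>X\<close> there are \<open>(X + 1) div 2\<close> odd and
    \<open>X div 2\<close> even rows; the factor 2 accounts for the two regions.\<close>
  have triv_sum: "(\<Sum>Z=1..X. card (A_row n Z) + card (B_row n Z))
      \<le> 2 * ((X + 1) div 2 * length L + X div 2 * length M)" for X
  proof (induction X)
    case (Suc X)
    have "(Suc X + 1) div 2 * length L + Suc X div 2 * length M
        = ((X + 1) div 2 * length L + X div 2 * length M) + length (if Suc X mod 2 = 0 then M else L)"
    proof (cases "even X")
      case True
      then have "(Suc X + 1) div 2 = (X + 1) div 2 + 1" "Suc X div 2 = X div 2" "Suc X mod 2 \<noteq> 0"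
        by presburger+
      then show ?thesis by (simp only: if_False add_mult_distrib)
    next
      case False
      then have "(Suc X + 1) div 2 = (X + 1) div 2" "Suc X div 2 = X div 2 + 1" "Suc X mod 2 = 0"
        by presburger+
      then show ?thesis by (simp only: if_True add_mult_distrib mult_1 add.assoc simp_thms)
    qed
    then show ?case using Suc triv[of "Suc X"] by (simp del: if_split)
  qed simp
  {
    case 0
    then show ?case by (subst (asm) rows.simps) (simp split: if_splits)
  next
    case (Suc X)
    show ?case
    proof (cases "c + 2 * ((Suc X + 1) div 2 * length L + Suc X div 2 * length M) < n")
      case True
      then show ?thesis using triv_sum[of "Suc X"] by linarith
    next
      case False
      let ?N = "if Suc X mod 2 = 0 then M else L" and ?k = "least_residue n (Suc X)"
      have "rows n L M (length L) (length M) X (c + row n (Suc X) ?k ?N)"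
        using Suc.prems False by (subst (asm) rows.simps) (simp only: if_False if_True diff_Suc_1 nat.distinct)
      then have "c + row n (Suc X) ?k ?N + (\<Sum>Z=1..X. card (A_row n Z) + card (B_row n Z)) < n"
        by (rule Suc.IH)
      moreover have "card (A_row n (Suc X)) \<le> length (filter (\<lambda>(a, b). ?k dvd a + Suc X) ?N)"
        by (rule card_subset_filter[OF sub(1)]) (auto simp: A_row_def A_pairs_def)
      moreover have "card (B_row n (Suc X)) \<le> length (filter (\<lambda>(a, b). b * Suc X < n \<and> 2 < b \<and>
          (Suc X + 1) * (2 * Suc X + 1) \<le> n + b * Suc X) ?N)"
        by (rule card_subset_filter[OF sub(2)]) (auto simp: B_row_def B_pairs_def)
      ultimately show ?thesis unfolding row_eq by simp
    qed
  }
qed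

lemma card_A_B_pairs_le:
  assumes "0 < n" "n \<le> r * r"
  shows "card (A_pairs n) + card (B_pairs n) \<le> (\<Sum>Z=1..r - 1. card (A_row n Z) + card (B_row n Z))"
proof -
  have small: "X \<in> {1..r - 1}" if "0 < X" "X * X < n" for X
  proof -
    have "X < r"
    proof (rule ccontr)
      assume "\<not> X < r"
      then have "r * r \<le> X * X" by (intro mult_le_mono) auto
      then show False using that assms(2) by linarith
    qed
    then show ?thesis using that by simp
  qed
  have small_A: "X \<in> {1..r - 1}" if "(X, a, b) \<in> A_pairs n" for X a b
    using that small unfolding A_pairs_def by blast
  have small_B: "X \<in> {1..r - 1}" if "(X, a, b) \<in> B_pairs n" for X a b
    using that small unfolding B_pairs_def by blast
  have fin: "finite (A_row n Z)" "finite (B_row n Z)" for Z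
    by (rule finite_subset[OF _ finite_divisor_pairs[OF assms(1)]];
        auto simp: A_row_def B_row_def A_pairs_def B_pairs_def)+
  have "A_pairs n \<subseteq> (SIGMA Z:{1..r - 1}. A_row n Z)" "B_pairs n \<subseteq> (SIGMA Z:{1..r - 1}. B_row n Z)"
    using small_A small_B by (auto simp: A_row_def B_row_def)
  moreover have "finite (SIGMA Z:{1..r - 1}. A_row n Z)" "finite (SIGMA Z:{1..r - 1}. B_row n Z)"
    using fin by simp_all
  ultimately have "card (A_pairs n) \<le> card (SIGMA Z:{1..r - 1}. A_row n Z)"
    "card (B_pairs n) \<le> card (SIGMA Z:{1..r - 1}. B_row n Z)"
    by (meson card_mono)+
  then show ?thesis using fin by (simp add: card_SigmaI sum.distrib)
qed

section \<open>Direct enumeration of the parameters\<close>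

definition brute_quotient :: "nat \<Rightarrow> nat \<Rightarrow> nat \<Rightarrow> nat \<Rightarrow> nat \<Rightarrow> bool" where
  "brute_quotient a b X k Y = (if (b + Y) mod k = 0 then if 2 * k \<le> b + Y then
     if X < Y then True else if X = Y then b < a else False else False else False)"

definition brute_test :: "nat \<Rightarrow> nat \<Rightarrow> nat \<Rightarrow> nat \<Rightarrow> nat \<Rightarrow> bool" where
  "brute_test n a b X k = (if k = 0 then False else if (a + X) mod k = 0 then
     if k < n then brute_quotient a b X k ((n - k) div X) else False else False)"

text \<open>The candidates for \<open>k\<close> are congruent to \<open>n\<close> modulo
  \<open>X\<close>. Their range comes from \<open>2 * k \<le> a + X\<close>, which expresses that
  \<open>y\<close> is at least 2; the matching condition for \<open>x\<close> is tested in
  \<open>brute_quotient\<close>.\<close>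

definition brute_row :: "nat \<Rightarrow> nat \<Rightarrow> nat \<Rightarrow> nat \<Rightarrow> nat" where
  "brute_row n a b X = length (filter (brute_test n a b X)
     (map (\<lambda>j. n mod X + j * X) [0..<(a + X) div (2 * X) + 1]))"

definition brute_pair :: "nat \<Rightarrow> nat \<Rightarrow> nat \<times> nat \<Rightarrow> nat" where
  "brute_pair n r p = sum_list (map (brute_row n (fst p) (snd p)) [1..<r])"

text \<open>A tuple is determined by \<open>a\<close>, \<open>b\<close>, \<open>X\<close> and
  \<open>k\<close>: first \<open>Y\<close> from \<open>X * Y + k = n\<close>, then \<open>x\<close>
  and \<open>y\<close>.\<close>

lemma card_params_le_brute:
  assumes "0 < n" "n \<le> r * r" "{(a, b). a * b = n} \<subseteq> set L"
  shows "card (params n) \<le> sum_list (map (brute_pair n r) L)"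
proof -
  let ?ks = "\<lambda>a b X. filter (brute_test n a b X) (map (\<lambda>j. n mod X + j * X) [0..<(a + X) div (2 * X) + 1])"
  let ?T = "SIGMA p:{(a, b). a * b = n}. SIGMA X:{1..<r}. set (?ks (fst p) (snd p) X)"
  let ?g = "\<lambda>(X, x, Y, y, a, b, k). ((a, b), X, k) :: (nat \<times> nat) \<times> nat \<times> nat"
  have fin: "finite ?T" using finite_divisor_pairs[OF assms(1)] by (intro finite_SigmaI) auto
  have "card (params n) \<le> card ?T"
  proof (rule card_inj_on_le[OF _ _ fin])
    show "inj_on ?g (params n)"
    proof (rule inj_onI, clarsimp)
      fix X x Y y a b k x' Y' y'
      assume p: "(X, x, Y, y, a, b, k) \<in> params n" "(X, x', Y', y', a, b, k) \<in> params n"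
      note q = paramsD[OF p(1)] and q' = paramsD[OF p(2)]
      have "X * Y = X * Y'" using q(7) q'(7) by linarith
      then have "Y = Y'" using q(1) by simp
      then have "k * x = k * x'" "k * y = k * y'" using q(8,9) q'(8,9) by simp_all
      then show "x = x' \<and> Y = Y' \<and> y = y'" using q(5) \<open>Y = Y'\<close> by simp
    qed
    show "?g ` params n \<subseteq> ?T"
    proof
      fix u assume "u \<in> ?g ` params n"
      then obtain X x Y y a b k
        where p: "(X, x, Y, y, a, b, k) \<in> params n" and u: "u = ((a, b), X, k)"
        by auto
      note q = paramsD[OF p]
      have Xr: "X < r"
      proof (rule ccontr)
        assume "\<not> X < r"
        then have "r * r \<le> X * X" by (intro mult_le_mono) auto
        then show False using params_square[OF p] assms(2) by linarith
      qed
      have kn: "k < n" "n - k = X * Y" using q(1,2,7) by auto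
      then have Y: "(n - k) div X = Y" using q(1) by simp
      have "k * 2 \<le> k * x" "k * 2 \<le> k * y" using q(3,4) by (intro mult_le_mono2; simp)+
      then have k2: "2 * k \<le> b + Y" "2 * k \<le> a + X" using q(8,9) by simp_all
      have m: "(b + Y) mod k = 0" "(a + X) mod k = 0"
        unfolding q(8)[symmetric] q(9)[symmetric] by simp_all
      have "brute_quotient a b X k Y"
        using m k2 q(13) by (auto simp: brute_quotient_def)
      then have t: "brute_test n a b X k"
        using m kn q(5) Y by (simp add: brute_test_def)
      have "n mod X = k mod X" unfolding q(7)[symmetric] by simp
      then have "k = n mod X + (k div X) * X" by simp
      moreover have "k div X < (a + X) div (2 * X) + 1"
      proof -
        have "k div X \<le> ((a + X) div 2) div X" using k2 by (intro div_le_mono) simp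
        then show ?thesis by (simp add: div_mult2_eq)
      qed
      ultimately have "k \<in> set (map (\<lambda>j. n mod X + j * X) [0..<(a + X) div (2 * X) + 1])"
        unfolding set_map by (intro image_eqI[of _ _ "k div X"]) (simp_all del: upt_Suc)
      then show "u \<in> ?T" unfolding u using t q(1,6) Xr by (simp del: upt_Suc)
    qed
  qed
  also have "card ?T = (\<Sum>p\<in>{(a, b). a * b = n}. card (SIGMA X:{1..<r}. set (?ks (fst p) (snd p) X)))"
    using finite_divisor_pairs[OF assms(1)] by (intro card_SigmaI) auto
  also have "\<dots> \<le> (\<Sum>p\<in>{(a, b). a * b = n}. brute_pair n r p)"
  proof (rule sum_mono)
    fix p
    have "card (SIGMA X:{1..<r}. set (?ks (fst p) (snd p) X)) = (\<Sum>X\<in>{1..<r}. card (set (?ks (fst p) (snd p) X)))"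
      by (intro card_SigmaI) auto
    also have "\<dots> \<le> (\<Sum>X\<in>{1..<r}. brute_row n (fst p) (snd p) X)"
      unfolding brute_row_def by (intro sum_mono card_length)
    also have "\<dots> = brute_pair n r p"
      unfolding brute_pair_def interv_sum_list_conv_sum_set_nat by simp
    finally show "card (SIGMA X:{1..<r}. set (?ks (fst p) (snd p) X)) \<le> brute_pair n r p" .
  qed
  also have "\<dots> \<le> sum_list (map (brute_pair n r) L)"
    by (rule sum_le_sum_list[OF assms(3)])
  finally show ?thesis .
qed

section \<open>Checking a single \<open>n\<close>\<close>

definition check_pairs :: "nat \<Rightarrow> nat \<Rightarrow> (nat \<times> nat) list \<Rightarrow> (nat \<times> nat) list \<Rightarrow> bool" where
  "check_pairs n r L M = (if rows n L M (length L) (length M) (r - 1) (tail_count L (0, 0)) then True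
     else sum_list (map (brute_pair n r) L) < n)"

definition odd_second :: "nat \<times> nat \<Rightarrow> bool" where "odd_second p \<longleftrightarrow> snd p mod 2 = 1"

definition check_list :: "nat \<Rightarrow> nat \<Rightarrow> (nat \<times> nat) list \<Rightarrow> bool" where
  "check_list n r L = check_pairs n r L (filter odd_second L)"

definition check_root :: "nat \<Rightarrow> nat \<Rightarrow> bool" where
  "check_root n r = check_list n r (divisor_list n (filter (\<lambda>b. n mod b = 0) [1..<r + 1]))"

text \<open>The value 1 is among the numbers visited, with all exponents 0 and cofactor 1, and has
  to be passed.\<close>

definition check :: "nat \<Rightarrow> bool" where
  "check n = (if n \<le> 1 then True else check_root n (ceil_sqrt 0 n))"

lemma check_imp_less:
  assumes "1 < n" "check n"
  shows "f n < n"
proof -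
  define r where "r = ceil_sqrt 0 n"
  define L where "L = divisor_list n (filter (\<lambda>b. n mod b = 0) [1..<r + 1])"
  have n: "0 < n" "n \<le> r * r" using assms(1) ceil_sqrt_le by (auto simp: r_def)
  have L: "{(a, b). a * b = n} \<subseteq> set L" unfolding L_def by (rule divisor_pairs_subset[OF n])
  have "{(a, b). a * b = n \<and> odd b} \<subseteq> set (filter odd_second L)"
  proof clarify
    fix a b assume "n = a * b" "odd b"
    then show "(a, b) \<in> set (filter odd_second L)"
      using L by (auto simp: odd_second_def odd_iff_mod_2_eq_one)
  qed
  note M = this
  have "check_pairs n r L (filter odd_second L)"
    using assms by (simp add: check_def check_root_def check_list_def r_def L_def)
  then consider "rows n L (filter odd_second L) (length L) (length (filter odd_second L)) (r - 1) (tail_count L (0, 0))"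
    | "sum_list (map (brute_pair n r) L) < n"
    by (auto simp: check_pairs_def split: if_splits)
  then show ?thesis
  proof cases
    case 1
    from rows_bound[OF L M this] show ?thesis
      using card_A_B_pairs_le[OF n] card_C_D_pairs_le[OF n(1) L, of 0] f_le_pairs[OF n(1)] by linarith
  next
    case 2
    then show ?thesis
      using card_params_le_brute[OF n L] solution_classes_bound(2)[of n] by linarith
  qed
qed

section \<open>The finite list of exceptional \<open>n\<close>\<close>

definition rough :: "nat \<Rightarrow> bool" where
  "rough m = (if m mod 2 = 0 then False else if m mod 3 = 0 then False else
     if m mod 5 = 0 then False else m mod 7 \<noteq> 0)"

definition check_multiple :: "nat \<Rightarrow> nat \<Rightarrow> bool" where
  "check_multiple s m = check (s * m)"

text \<open>For \<open>t = 0\<close> the cofactor is 1. Otherwise it runs from \<open>11 ^ t\<close>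
  to the largest \<open>m\<close> with \<open>9 * s * m \<le> w * w\<close>, beyond which the
  divisor bound already suffices.\<close>

definition check_smooth :: "nat \<Rightarrow> nat \<Rightarrow> nat \<Rightarrow> bool" where
  "check_smooth t w s = list_all (check_multiple s)
     (if t = 0 then if 9 * s < w * w then [1] else []
      else filter rough [11 ^ t..<w * w div (9 * s) + 1])"

definition check_t :: "nat \<Rightarrow> nat \<Rightarrow> nat \<Rightarrow> nat \<Rightarrow> nat \<Rightarrow> bool" where
  "check_t e i j k t = check_smooth t (weight e i j k t) (smooth e i j k)"

text \<open>The ranges here and in the next three definitions are those of
  \<open>heavy_bounds\<close>.\<close>

definition check_k :: "nat \<Rightarrow> nat \<Rightarrow> nat \<Rightarrow> nat \<Rightarrow> bool" where
  "check_k e i j k = list_all (check_t e i j k) [0..<3]"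

definition check_j :: "nat \<Rightarrow> nat \<Rightarrow> nat \<Rightarrow> bool" where
  "check_j e i j = list_all (check_k e i j) [0..<4]"

definition check_i :: "nat \<Rightarrow> nat \<Rightarrow> bool" where
  "check_i e i = list_all (check_j e i) [0..<4]"

definition check_e :: "nat \<Rightarrow> bool" where
  "check_e e = list_all (check_i e) [0..<6]"

lemma check_e_0: "check_e 0" by code_simp
lemma check_e_1: "check_e 1" by code_simp
lemma check_e_2: "check_e 2" by code_simp
lemma check_e_3: "check_e 3" by code_simp
lemma check_e_4: "check_e 4" by code_simp
lemma check_e_5: "check_e 5" by code_simp
lemma check_e_6: "check_e 6" by code_simp
lemma check_e_7: "check_e 7" by code_simp
lemma check_e_8: "check_e 8" by code_simp
lemma check_e_9: "check_e 9" by code_simp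

lemma check_e_less_10:
  assumes "e < 10"
  shows "check_e e"
proof -
  have "e \<in> {0, 1, 2, 3, 4, 5, 6, 7, 8, 9}" using assms by auto
  then show ?thesis
    using check_e_0 check_e_1 check_e_2 check_e_3 check_e_4 check_e_5 check_e_6 check_e_7 check_e_8
      check_e_9 by blast
qed

lemma check_multiple_of_smooth:
  assumes "e < 10" "i < 6" "j < 4" "k < 4" "t < 3" "11 ^ t \<le> m" "t = 0 \<longrightarrow> m = 1"
    "\<not> 2 dvd m" "\<not> 3 dvd m" "\<not> 5 dvd m" "\<not> 7 dvd m"
    "9 * (smooth e i j k * m) < (weight e i j k t)\<^sup>2"
  shows "check (smooth e i j k * m)"
proof -
  let ?s = "smooth e i j k" and ?w = "weight e i j k t"
  have "check_i e i" using check_e_less_10[OF assms(1)] assms(2)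
    by (simp add: check_e_def list_all_iff del: upt_Suc)
  then have "check_j e i j" using assms(3) by (simp add: check_i_def list_all_iff del: upt_Suc)
  then have "check_k e i j k" using assms(4) by (simp add: check_j_def list_all_iff del: upt_Suc)
  then have "check_t e i j k t" using assms(5) by (simp add: check_k_def list_all_iff del: upt_Suc)
  then have c: "check_smooth t ?w ?s" by (simp add: check_t_def)
  show ?thesis
  proof (cases "t = 0")
    case True
    then show ?thesis using c assms(7,12) by (simp add: check_smooth_def check_multiple_def power2_eq_square)
  next
    case False
    have "m * (9 * ?s) \<le> ?w * ?w" using assms(12) by (simp add: power2_eq_square mult_ac)
    then have "m \<le> ?w * ?w div (9 * ?s)"
      by (simp add: less_eq_div_iff_mult_less_eq smooth_def)
    moreover have "rough m"
      using assms(8-11) by (simp add: rough_def dvd_eq_mod_eq_0)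
    ultimately have "check_multiple ?s m"
      using c False assms(6) by (simp add: check_smooth_def list_all_iff del: upt_Suc)
    then show ?thesis by (simp add: check_multiple_def)
  qed
qed

theorem mainTheorem1:
  fixes n :: nat
  assumes "n > 1"
  shows "finite (solution_classes n) \<and> f n < n"
proof
  show "finite (solution_classes n)" by (rule solution_classes_bound(1))
  show "f n < n"
  proof (rule ccontr)
    assume not_less: "\<not> f n < n"
    have "0 < n" using assms by simp
    from this not_less obtain e i j k t m where c: "e < 10" "i < 6" "j < 4" "k < 4" "t < 3"
      "n = smooth e i j k * m" "11 ^ t \<le> m" "t = 0 \<longrightarrow> m = 1" "\<not> 2 dvd m" "\<not> 3 dvd m"
      "\<not> 5 dvd m" "\<not> 7 dvd m" "9 * n < (weight e i j k t)\<^sup>2"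
      by (rule exceptional_cases)
    have "check n"
      unfolding c(6) using c(1-5,7-12) c(13)[unfolded c(6)] by (rule check_multiple_of_smooth)
    then show False using check_imp_less[OF assms] not_less by blast
  qed
qed

end
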